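(* Let $g\ge 1$ and $k\ge 0$ be integers, let $\Gamma_g$ be a chain of loops of genus $g$, and let $D_1,\dots,D_k$ be divisors on $\Gamma_g$. Then the Poincar\'e series $$P_{\Gamma_g,D_1,\dots,D_k}(z_1,\dots,z_k)=\sum_{(n_1,\dots,n_k)\in\mathbb{N}^k}\bigl(r_{\Gamma_g}(n_1D_1+\dots+n_kD_k)+1\bigr)z_1^{n_1}\cdots z_k^{n_k}$$ is rational: there exist polynomials $f,h\in\mathbb{Z}[z_1,\dots,z_k]$ such that the series equals $f/h$ at every point of $\mathbb{C}^k$ at which it converges absolutely.
   Context: $\mathbb{N}$ is the set of non-negative integers. A chain of loops $\Gamma_g$ of genus $g$ is the metric graph obtained as follows: for $i=1,\dots,g$, $L_i$ is a circle (loop) of length $\ell_i>0$; $L_i$ carries marked points $w_i$ (for $i\le g-1$) and $v_i$ (for $i\ge 2$); for $i=1,\dots,g-1$ the point $w_i\in L_i$ is joined to $v_{i+1}\in L_{i+1}$ by a segment (bridge) of nonnegative length. Divisors on a metric graph $\Gamma$ are finite formal $\mathbb{Z}$-combinations of points of $\Gamma$; degree and effectiveness are as usual. A rational function on $\Gamma$ is a continuous piecewise linear function $\Gamma\to\mathbb{R}$ with finitely many pieces and integer slopes; its principal divisor is ${\rm div}(f)=\sum_{p}\bigl(\sum_{e}{\rm slp}_e(f)\bigr)(p)$, where $e$ runs over the tangent directions at $p$ and ${\rm slp}_e(f)$ is the outgoing slope of $f$ along $e$. Linear equivalence, linear systems $|D|$ and the rank $r_\Gamma(D)$ are defined as for graphs: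 $r_\Gamma(D)=-1$ if $|D|=\emptyset$, otherwise the largest $r$ with $|D-E|\ne\emptyset$ for all effective $E$ of degree $r$.
   Formalization: "The series equals f/h" is stated as h nonzero and h·P = f at every point of absolute convergence, with P = f/h only where h does not vanish, since at some points of absolute convergence every possible h vanishes. *)

theory Defs
  imports "HOL-Analysis.Analysis" "HOL-Library.Poly_Mapping"
begin

section \<open>Metric graphs\<close>

text \<open>
  A metric graph is presented by finitely many closed segments \<open>{0..len e}\<close> (with \<open>len e \<ge> 0\<close>;
  a segment of length 0 is a single point) together with finitely many pairs of points of these
  segments that are to be identified. Identified points may lie in the interior of a segment.
  The points of the metric graph are the classes of the equivalence relation generated by the
  identifications; in particular, a segment of length 0 is contracted.
\<close>

record 'e metric_graph =
  segs :: "'e set"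
  len :: "'e \<Rightarrow> real"
  glue :: "(('e \<times> real) \<times> ('e \<times> real)) set"

type_synonym 'e point = "('e \<times> real) set"

definition raw_points :: "'e metric_graph \<Rightarrow> ('e \<times> real) set" where
  "raw_points G = (SIGMA e : segs G. {0..len G e})"

definition glue_rel :: "'e metric_graph \<Rightarrow> (('e \<times> real) \<times> ('e \<times> real)) set" where
  "glue_rel G = (glue G \<union> (glue G)\<inverse>)\<^sup>* \<inter> raw_points G \<times> raw_points G"

definition points :: "'e metric_graph \<Rightarrow> 'e point set" where
  "points G = raw_points G // glue_rel G"

definition point_of :: "'e metric_graph \<Rightarrow> 'e \<Rightarrow> real \<Rightarrow> 'e point" where
  "point_of G e t = glue_rel G `` {(e, t)}"

section \<open>Divisors\<close>

definition divisor :: "'e metric_graph \<Rightarrow> ('e point \<Rightarrow> int) \<Rightarrow> bool" where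
  "divisor G D \<longleftrightarrow> finite {p. D p \<noteq> 0} \<and> {p. D p \<noteq> 0} \<subseteq> points G"

definition deg :: "('e point \<Rightarrow> int) \<Rightarrow> int" where
  "deg D = (\<Sum>p | D p \<noteq> 0. D p)"

definition effective :: "('e point \<Rightarrow> int) \<Rightarrow> bool" where
  "effective D \<longleftrightarrow> (\<forall>p. D p \<ge> 0)"

section \<open>Rational functions and linear equivalence\<close>

text \<open>
  \<open>xs\<close> lists the breakpoints. The formulas hold on closed pieces, so \<open>\<phi>\<close> is continuous on \<open>{0..L}\<close>.
\<close>

definition piecewise_integer_linear :: "real \<Rightarrow> (real \<Rightarrow> real) \<Rightarrow> bool" where
  "piecewise_integer_linear L \<phi> \<longleftrightarrow>
     (\<exists>xs. xs \<noteq> [] \<and> sorted xs \<and> hd xs = 0 \<and> last xs = L \<and>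
        (\<forall>i. Suc i < length xs \<longrightarrow>
           (\<exists>m::int. \<forall>t\<in>{xs ! i..xs ! Suc i}. \<phi> t = \<phi> (xs ! i) + of_int m * (t - xs ! i))))"

text \<open>
  Since the metric graph carries the quotient topology, a function on it is continuous iff its
  restriction to every segment is.
\<close>

definition rational_function :: "'e metric_graph \<Rightarrow> ('e point \<Rightarrow> real) \<Rightarrow> bool" where
  "rational_function G f \<longleftrightarrow>
     (\<forall>e\<in>segs G. piecewise_integer_linear (len G e) (\<lambda>t. f (point_of G e t)))"

text \<open>
  The tangent directions at \<open>p\<close>: every representative \<open>(e, t)\<close> of \<open>p\<close> contributes the direction of
  increasing parameter (\<open>s = 1\<close>) unless \<open>t\<close> is the right end of the segment, and the direction of
  decreasing parameter (\<open>s = -1\<close>) unless \<open>t\<close> is the left end.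
\<close>

definition tangent_directions :: "'e metric_graph \<Rightarrow> 'e point \<Rightarrow> ('e \<times> real \<times> real) set" where
  "tangent_directions G p =
     {(e, t, s). (e, t) \<in> p \<and> (s = 1 \<and> t < len G e \<or> s = -1 \<and> 0 < t)}"

definition outgoing_slope ::
    "'e metric_graph \<Rightarrow> ('e point \<Rightarrow> real) \<Rightarrow> ('e \<times> real \<times> real) \<Rightarrow> int" where
  "outgoing_slope G f = (\<lambda>(e, t, s). THE m. \<forall>\<^sub>F h in at_right 0.
     f (point_of G e (t + s * h)) = f (point_of G e t) + of_int m * h)"

definition principal_divisor :: "'e metric_graph \<Rightarrow> ('e point \<Rightarrow> real) \<Rightarrow> 'e point \<Rightarrow> int" where
  "principal_divisor G f p =
     (if p \<in> points G then \<Sum>d\<in>tangent_directions G p. outgoing_slope G f d else 0)"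

definition linearly_equivalent ::
    "'e metric_graph \<Rightarrow> ('e point \<Rightarrow> int) \<Rightarrow> ('e point \<Rightarrow> int) \<Rightarrow> bool" where
  "linearly_equivalent G D D' \<longleftrightarrow>
     (\<exists>f. rational_function G f \<and> (\<forall>p. D p - D' p = principal_divisor G f p))"

definition linear_system :: "'e metric_graph \<Rightarrow> ('e point \<Rightarrow> int) \<Rightarrow> ('e point \<Rightarrow> int) set" where
  "linear_system G D = {E. divisor G E \<and> effective E \<and> linearly_equivalent G D E}"

definition divisor_rank :: "'e metric_graph \<Rightarrow> ('e point \<Rightarrow> int) \<Rightarrow> int" where
  "divisor_rank G D =
     (if linear_system G D = {} then -1
      else int (GREATEST r::nat. \<forall>E. divisor G E \<and> effective E \<and> deg E = int r \<longrightarrow>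
                  linear_system G (\<lambda>p. D p - E p) \<noteq> {}))"

section \<open>Chains of loops\<close>

datatype chain_segment = Loop nat | Bridge nat

text \<open>
  The \<open>i\<close>-th loop is a segment of length \<open>l i\<close> with its two ends identified, and the \<open>i\<close>-th bridge
  joins \<open>w i\<close> on loop \<open>i\<close> to \<open>v (Suc i)\<close> on loop \<open>Suc i\<close>. A bridge of length \<open>0\<close> identifies these
  two points. The marked points of a loop are arbitrary; they may coincide.
\<close>

definition is_chain_of_loops :: "nat \<Rightarrow> chain_segment metric_graph \<Rightarrow> bool" where
  "is_chain_of_loops g G \<longleftrightarrow>
     (\<exists>l v w b :: nat \<Rightarrow> real.
        (\<forall>i\<in>{1..g}. 0 < l i) \<and>
        (\<forall>i\<in>{2..g}. v i \<in> {0..<l i}) \<and>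
        (\<forall>i\<in>{1..<g}. w i \<in> {0..<l i} \<and> 0 \<le> b i) \<and>
        G = \<lparr> segs = Loop ` {1..g} \<union> Bridge ` {1..<g},
              len = (\<lambda>e. case e of Loop i \<Rightarrow> l i | Bridge i \<Rightarrow> b i),
              glue = {((Loop i, 0), (Loop i, l i)) | i. i \<in> {1..g}}
                   \<union> {((Loop i, w i), (Bridge i, 0)) | i. i \<in> {1..<g}}
                   \<union> {((Bridge i, b i), (Loop (Suc i), v (Suc i))) | i. i \<in> {1..<g}} \<rparr>)"

section \<open>Polynomials in several variables and Poincare series\<close>

text \<open>
  \<open>exponents k\<close> represents the set of \<open>k\<close>-tuples of naturals, indexed by \<open>0, \<dots>, k - 1\<close>. Elements of
  the ring \<open>(nat \<Rightarrow>\<^sub>0 nat) \<Rightarrow>\<^sub>0 int\<close> with keys in \<open>exponents k\<close> are the polynomials in \<open>k\<close> variables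
  over the integers.
\<close>

definition exponents :: "nat \<Rightarrow> (nat \<Rightarrow>\<^sub>0 nat) set" where
  "exponents k = {n. Poly_Mapping.keys n \<subseteq> {..<k}}"

definition int_polys :: "nat \<Rightarrow> ((nat \<Rightarrow>\<^sub>0 nat) \<Rightarrow>\<^sub>0 int) set" where
  "int_polys k = {f. Poly_Mapping.keys f \<subseteq> exponents k}"

definition monomial_at :: "nat \<Rightarrow> (nat \<Rightarrow> complex) \<Rightarrow> (nat \<Rightarrow>\<^sub>0 nat) \<Rightarrow> complex" where
  "monomial_at k z n = (\<Prod>i<k. z i ^ Poly_Mapping.lookup n i)"

definition poly_at :: "nat \<Rightarrow> (nat \<Rightarrow> complex) \<Rightarrow> ((nat \<Rightarrow>\<^sub>0 nat) \<Rightarrow>\<^sub>0 int) \<Rightarrow> complex" where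
  "poly_at k z f =
     (\<Sum>n\<in>Poly_Mapping.keys f. of_int (Poly_Mapping.lookup f n) * monomial_at k z n)"

definition poincare_term ::
    "'e metric_graph \<Rightarrow> nat \<Rightarrow> (nat \<Rightarrow> 'e point \<Rightarrow> int) \<Rightarrow> (nat \<Rightarrow> complex) \<Rightarrow>
     (nat \<Rightarrow>\<^sub>0 nat) \<Rightarrow> complex" where
  "poincare_term G k D z n =
     of_int (divisor_rank G (\<lambda>p. \<Sum>i<k. int (Poly_Mapping.lookup n i) * D i p) + 1)
       * monomial_at k z n"

end

theory Submission
  imports Defs "HOL-Library.Real_Mod"
begin

text \<open>
  The Picard group of a chain of loops is \<open>\<int>\<close> times a product of circles, one for each loop. In
  these coordinates the effective classes of given degree form a finite union of coordinate subtori,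
  so that membership of a class depends only on which of finitely many constants its coordinates are
  equal to. Since circles are infinite, a back-and-forth argument eliminates the quantifier over
  effective divisors in the definition of the rank, and the rank in given degree depends only on such
  equalities as well. The rank is \<open>-1\<close> in negative degree and \<open>d - g\<close> in degree \<open>d \<ge> 2 g - 1\<close>.
  Hence the coefficients of the series differ from \<open>max 0 (d n - g + 1)\<close>, where \<open>d\<close> is linear, by a
  function that is a Boolean combination of conditions on \<open>n\<close> each of which defines the intersection
  of \<open>\<nat>\<^sup>k\<close> with a coset of a subgroup. The generating functions of both are rational,
  by induction on the number of variables.
\<close>

section \<open>Rational generating functions\<close>

text \<open>Finitely many conditions suffice because finitely many degrees matter: subtracting the
  piecewise linear term leaves a function that vanishes outside the degrees from \<open>0\<close> to
  \<open>2 g - 2\<close>, and in each of these degrees only finitely many constants occur. Since the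
  \<open>D i\<close> may have degrees of either sign, one degree can be attained by infinitely many
  exponents; the degree is therefore treated as one more condition, alongside the torus coordinates.
  Degree and coordinates are additive in the exponent, so the set cut out by each condition is
  stable under \<open>x + y - z\<close>. This property survives translations and intersections and
  already makes the indicator rational, with torsion coordinates and coordinates of infinite order
  treated alike. Complements enter by subtraction. The threshold \<open>2 g - 1\<close> comes from
  two facts with the same bound: every class of degree at least \<open>g\<close> is effective, while
  in each degree below \<open>g\<close> a generic class is not.\<close>

type_synonym expo = "nat \<Rightarrow>\<^sub>0 nat"

text \<open>On generating functions \<open>shift m\<close> is multiplication by the monomial with
  exponent \<open>m\<close>, so \<open>diff_op m\<close> is multiplication by one minus that
  monomial. The existence test guards the truncated subtraction.\<close>

definition shift :: "expo \<Rightarrow> (expo \<Rightarrow> int) \<Rightarrow> expo \<Rightarrow> int" where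
  "shift m a n = (if \<exists>q. n = m + q then a (n - m) else 0)"

definition diff_op :: "expo \<Rightarrow> (expo \<Rightarrow> int) \<Rightarrow> expo \<Rightarrow> int" where
  "diff_op m a = (\<lambda>n. a n - shift m a n)"

text \<open>
  The generating function of \<open>a\<close> is a polynomial divided by a product of factors \<open>1 - z\<^sup>m\<close>.
\<close>

definition rational_gf :: "nat \<Rightarrow> (expo \<Rightarrow> int) \<Rightarrow> bool" where
  "rational_gf k a \<longleftrightarrow>
     (\<exists>ms. set ms \<subseteq> exponents k - {0} \<and> finite {n. fold diff_op ms a n \<noteq> 0})"

text \<open>Restriction to a coordinate face of the orthant. Keeping the full exponent type lets the
  inductions below run over the set \<open>I\<close> of live variables.\<close>

definition on_vars :: "nat set \<Rightarrow> (expo \<Rightarrow> int) \<Rightarrow> expo \<Rightarrow> int" where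
  "on_vars I a n = (if Poly_Mapping.keys n \<subseteq> I then a n else 0)"

section \<open>Calculus of shifts and difference operators\<close>

lemma keys_plus_nat: "Poly_Mapping.keys (m + n :: expo) = Poly_Mapping.keys m \<union> Poly_Mapping.keys n"
  by (auto simp: in_keys_iff lookup_add)

lemma shift_plus [simp]: "shift m a (m + q) = a q"
  by (auto simp: shift_def)

lemma shift_plus' [simp]: "shift m a (q + m) = a q"
  by (metis add.commute shift_plus)

lemma shift_eq_0: "\<nexists>q. n = m + q \<Longrightarrow> shift m a n = 0"
  by (auto simp: shift_def)

lemma shift_shift: "shift m (shift m' a) = shift (m + m') a"
proof
  fix n
  show "shift m (shift m' a) n = shift (m + m') a n"
  proof (cases "\<exists>q. n = m + m' + q")
    case True
    then obtain q where "n = m + (m' + q)" "n = m + m' + q" by (auto simp: add.assoc)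
    then show ?thesis by (metis shift_plus)
  next
    case False
    then have "shift (m + m') a n = 0" by (rule shift_eq_0)
    moreover have "shift m (shift m' a) n = 0"
    proof (cases "\<exists>q. n = m + q")
      case True
      then obtain q where q: "n = m + q" by auto
      with False have "\<nexists>q'. q = m' + q'" by (auto simp: add.assoc)
      then show ?thesis using q by (simp add: shift_eq_0)
    qed (rule shift_eq_0)
    ultimately show ?thesis by simp
  qed
qed

lemma shift_diff: "shift m (\<lambda>n. a n - b n) = (\<lambda>n. shift m a n - shift m b n)"
  by (auto simp: shift_def)

lemma shift_add: "shift m (\<lambda>n. a n + b n) = (\<lambda>n. shift m a n + shift m b n)"
  by (auto simp: shift_def)

lemma shift_cmult: "shift m (\<lambda>n. c * a n) = (\<lambda>n. c * shift m a n)"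
  by (auto simp: shift_def)

lemma finite_support_shift:
  assumes "finite {n. a n \<noteq> 0}"
  shows "finite {n. shift m a n \<noteq> 0}"
proof (rule finite_subset)
  show "{n. shift m a n \<noteq> 0} \<subseteq> (+) m ` {n. a n \<noteq> 0}"
    by (auto simp: shift_def split: if_splits)
qed (use assms in simp)

lemma diff_op_shift: "diff_op m (shift m' a) = shift m' (diff_op m a)"
  by (simp add: diff_op_def shift_diff shift_shift add.commute)

lemma diff_op_commute: "diff_op m \<circ> diff_op m' = diff_op m' \<circ> diff_op m"
  by (auto simp: fun_eq_iff diff_op_def shift_diff shift_shift add.commute)

lemma diff_op_add: "diff_op m (\<lambda>n. a n + b n) = (\<lambda>n. diff_op m a n + diff_op m b n)"
  by (auto simp: diff_op_def shift_add)

lemma diff_op_cmult: "diff_op m (\<lambda>n. c * a n) = (\<lambda>n. c * diff_op m a n)"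
  by (auto simp: diff_op_def shift_cmult algebra_simps)

lemma finite_support_diff_op:
  assumes "finite {n. a n \<noteq> 0}"
  shows "finite {n. diff_op m a n \<noteq> 0}"
proof (rule finite_subset)
  show "{n. diff_op m a n \<noteq> 0} \<subseteq> {n. a n \<noteq> 0} \<union> {n. shift m a n \<noteq> 0}"
    by (auto simp: diff_op_def)
qed (use assms finite_support_shift in auto)

lemma fold_diff_op_shift: "fold diff_op ms (shift m a) = shift m (fold diff_op ms a)"
  by (induction ms arbitrary: a) (simp_all add: diff_op_shift)

lemma fold_diff_op_add:
  "fold diff_op ms (\<lambda>n. a n + b n) = (\<lambda>n. fold diff_op ms a n + fold diff_op ms b n)"
  by (induction ms arbitrary: a b) (simp_all add: diff_op_add)

lemma fold_diff_op_cmult: "fold diff_op ms (\<lambda>n. c * a n) = (\<lambda>n. c * fold diff_op ms a n)"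
  by (induction ms arbitrary: a) (simp_all add: diff_op_cmult)

lemma fold_diff_op_commute:
  "fold diff_op ms (diff_op m a) = diff_op m (fold diff_op ms a)"
proof (induction ms arbitrary: a)
  case (Cons m' ms)
  have "diff_op m' (diff_op m a) = diff_op m (diff_op m' a)"
    using fun_cong[OF diff_op_commute, of m' m a] by simp
  then show ?case using Cons by simp
qed simp

lemma fold_diff_op_swap:
  "fold diff_op ms (fold diff_op ms' a) = fold diff_op ms' (fold diff_op ms a)"
  by (induction ms arbitrary: a) (simp_all add: fold_diff_op_commute)

lemma finite_support_fold_diff_op:
  "finite {n. a n \<noteq> 0} \<Longrightarrow> finite {n. fold diff_op ms a n \<noteq> 0}"
  by (induction ms arbitrary: a) (simp_all add: finite_support_diff_op)

section \<open>Closure properties of rational generating functions\<close>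

lemma rational_gf_finite: "finite {n. a n \<noteq> 0} \<Longrightarrow> rational_gf k a"
  unfolding rational_gf_def by (rule exI[of _ "[]"]) auto

lemma rational_gf_zero: "rational_gf k (\<lambda>_. 0)"
  by (rule rational_gf_finite) auto

lemma rational_gf_shift: "rational_gf k a \<Longrightarrow> rational_gf k (shift m a)"
  unfolding rational_gf_def by (metis finite_support_shift fold_diff_op_shift)

text \<open>The concatenated list is a common denominator: the operators commute, and each of them
  preserves finite support.\<close>

lemma rational_gf_add:
  assumes "rational_gf k a" "rational_gf k b"
  shows "rational_gf k (\<lambda>n. a n + b n)"
proof -
  obtain ms ms' where ms: "set ms \<subseteq> exponents k - {0}" "finite {n. fold diff_op ms a n \<noteq> 0}"
    and ms': "set ms' \<subseteq> exponents k - {0}" "finite {n. fold diff_op ms' b n \<noteq> 0}"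
    using assms unfolding rational_gf_def by blast
  define a' where "a' = fold diff_op (ms @ ms') a"
  define b' where "b' = fold diff_op (ms @ ms') b"
  have "finite {n. a' n \<noteq> 0}"
    using finite_support_fold_diff_op[OF ms(2), of ms'] by (simp add: a'_def)
  moreover have "finite {n. b' n \<noteq> 0}"
    using finite_support_fold_diff_op[OF ms'(2), of ms] by (simp add: b'_def fold_diff_op_swap)
  ultimately have "finite ({n. a' n \<noteq> 0} \<union> {n. b' n \<noteq> 0})" by simp
  then have "finite {n. a' n + b' n \<noteq> 0}" by (rule rev_finite_subset) auto
  then have "finite {n. fold diff_op (ms @ ms') (\<lambda>n. a n + b n) n \<noteq> 0}"
    by (simp only: fold_diff_op_add a'_def b'_def)
  then show ?thesis using ms(1) ms'(1) unfolding rational_gf_def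
    by (intro exI[of _ "ms @ ms'"]) auto
qed

lemma rational_gf_cmult: "rational_gf k a \<Longrightarrow> rational_gf k (\<lambda>n. c * a n)"
proof -
  assume "rational_gf k a"
  then obtain ms where ms: "set ms \<subseteq> exponents k - {0}" "finite {n. fold diff_op ms a n \<noteq> 0}"
    unfolding rational_gf_def by blast
  have "finite {n. c * fold diff_op ms a n \<noteq> 0}"
    by (rule rev_finite_subset[OF ms(2)]) auto
  then show ?thesis unfolding rational_gf_def fold_diff_op_cmult using ms(1) by blast
qed

lemma rational_gf_diff:
  assumes "rational_gf k a" "rational_gf k b"
  shows "rational_gf k (\<lambda>n. a n - b n)"
  using rational_gf_add[OF assms(1) rational_gf_cmult[OF assms(2), of "-1"]] by simp

lemma rational_gf_diff_op:
  assumes "m \<in> exponents k - {0}" "rational_gf k (diff_op m a)"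
  shows "rational_gf k a"
proof -
  obtain ms where "set ms \<subseteq> exponents k - {0}" "finite {n. fold diff_op ms (diff_op m a) n \<noteq> 0}"
    using assms(2) unfolding rational_gf_def by blast
  then show ?thesis using assms(1) unfolding rational_gf_def
    by (intro exI[of _ "m # ms"]) auto
qed

lemma rational_gf_on_vars_empty: "rational_gf k (on_vars {} a)"
proof (rule rational_gf_finite, rule finite_subset)
  show "{n. on_vars {} a n \<noteq> 0} \<subseteq> {0}" by (auto simp: on_vars_def)
qed simp

section \<open>Recurrences and reduction to fewer variables\<close>

lemma single_decompose:
  fixes m :: expo
  assumes "i \<in> Poly_Mapping.keys m"
  obtains m' where "m = m' + Poly_Mapping.single i 1" "Poly_Mapping.keys m' \<subseteq> Poly_Mapping.keys m"
proof
  show "m = (m - Poly_Mapping.single i 1) + Poly_Mapping.single i 1"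
    using assms by (intro poly_mapping_eqI) (auto simp: lookup_add lookup_minus lookup_single when_def in_keys_iff)
  show "Poly_Mapping.keys (m - Poly_Mapping.single i 1) \<subseteq> Poly_Mapping.keys m"
    by (auto simp: in_keys_iff lookup_minus)
qed

text \<open>
  The part of \<open>a\<close> outside of a translated orthant decomposes into slices in fewer variables.
\<close>

lemma rational_gf_boundary:
  assumes "Poly_Mapping.keys m \<subseteq> I"
    and slice: "\<And>i m. i \<in> I \<Longrightarrow> Poly_Mapping.keys m \<subseteq> I \<Longrightarrow> rational_gf k (on_vars (I - {i}) (\<lambda>n. a (n + m)))"
  shows "rational_gf k (\<lambda>n. if \<exists>q. n = m + q then 0 else on_vars I a n)"
  using assms(1)
proof (induction "\<Sum>i\<in>Poly_Mapping.keys m. Poly_Mapping.lookup m i" arbitrary: m rule: less_induct)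
  case less
  show ?case
  proof (cases "m = 0")
    case True
    then show ?thesis by (simp add: rational_gf_zero)
  next
    case False
    then obtain i where i: "i \<in> Poly_Mapping.keys m" by fastforce
    then obtain m' where m': "m = m' + Poly_Mapping.single i 1"
      "Poly_Mapping.keys m' \<subseteq> Poly_Mapping.keys m"
      by (rule single_decompose)
    have "(\<Sum>j\<in>Poly_Mapping.keys m'. Poly_Mapping.lookup m' j) = (\<Sum>j\<in>Poly_Mapping.keys m. Poly_Mapping.lookup m' j)"
      using m'(2) by (intro sum.mono_neutral_left) (auto simp: in_keys_iff)
    also have "\<dots> < (\<Sum>j\<in>Poly_Mapping.keys m. Poly_Mapping.lookup m j)"
      using i by (intro sum_strict_mono_ex1) (auto simp: m'(1) lookup_add intro!: bexI[of _ i])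
    finally have IH: "rational_gf k (\<lambda>n. if \<exists>q. n = m' + q then 0 else on_vars I a n)"
      using less m'(2) by fastforce
    \<comment> \<open>Points above \<open>m'\<close> but not above \<open>m\<close> are the
      \<open>m' + q\<close> with \<open>q\<close> free of the variable \<open>i\<close>. They form a
      single slice, and \<open>s\<close> is the restriction of \<open>a\<close> to it.\<close>
    define s where "s = shift m' (on_vars (I - {i}) (\<lambda>q. a (q + m')))"
    have s: "rational_gf k s"
      unfolding s_def using less.prems m'(2) i by (intro rational_gf_shift slice) auto
    have "(if \<exists>q. n = m + q then 0 else on_vars I a n) =
      (if \<exists>q. n = m' + q then 0 else on_vars I a n) + s n" for n
    proof (cases "\<exists>q. n = m' + q")
      case True
      then obtain q where q: "n = m' + q" by auto
      have s_n: "s n = on_vars (I - {i}) (\<lambda>q. a (q + m')) q"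
        by (simp add: s_def q)
      have "(\<exists>q'. n = m + q') \<longleftrightarrow> i \<in> Poly_Mapping.keys q"
      proof
        assume "\<exists>q'. n = m + q'"
        then obtain q' where "q = Poly_Mapping.single i 1 + q'"
          using q m'(1) by (auto simp: add.assoc)
        then show "i \<in> Poly_Mapping.keys q" by (simp add: keys_plus_nat)
      next
        assume "i \<in> Poly_Mapping.keys q"
        then obtain q' where "q = q' + Poly_Mapping.single i 1" by (rule single_decompose)
        then show "\<exists>q'. n = m + q'" using q m'(1) by (metis add.assoc add.commute)
      qed
      moreover have "Poly_Mapping.keys n \<subseteq> I \<longleftrightarrow> Poly_Mapping.keys q \<subseteq> I"
        using q less.prems m'(2) by (auto simp: keys_plus_nat)
      ultimately show ?thesis using True q s_n by (auto simp: on_vars_def add.commute)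
    next
      case False
      then have "\<nexists>q. n = m + q" using m'(1) by (auto simp: add.assoc)
      then show ?thesis using False by (simp add: s_def shift_eq_0)
    qed
    then show ?thesis using rational_gf_add[OF IH s] by (simp only:)
  qed
qed

text \<open>Multiplying the series by \<open>1 - c z^m\<close> leaves a translate of the differences
  \<open>a (n + m) - c * a n\<close> and a boundary made of slices in fewer variables. With
  \<open>c = 1\<close> this solves a recurrence, and \<open>m \<noteq> 0\<close> keeps the
  denominator nonzero; with \<open>c = 0\<close> it says that \<open>a\<close> need only be
  understood on a translated orthant.\<close>

lemma rational_gf_step:
  assumes "I \<subseteq> {..<k}" and m: "Poly_Mapping.keys m \<subseteq> I" and c: "c = 0 \<or> c = 1 \<and> m \<noteq> 0"
    and diff: "rational_gf k (on_vars I (\<lambda>n. a (n + m) - c * a n))"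
    and slice: "\<And>i m. i \<in> I \<Longrightarrow> Poly_Mapping.keys m \<subseteq> I \<Longrightarrow> rational_gf k (on_vars (I - {i}) (\<lambda>n. a (n + m)))"
  shows "rational_gf k (on_vars I a)"
proof -
  define b where "b = (\<lambda>n. if \<exists>q. n = m + q then 0 else on_vars I a n)"
  define d where "d = on_vars I (\<lambda>n. a (n + m) - c * a n)"
  have eq: "on_vars I a n - c * shift m (on_vars I a) n = shift m d n + b n" for n
  proof (cases "\<exists>q. n = m + q")
    case True
    then obtain q where q: "n = m + q" by auto
    have "Poly_Mapping.keys n \<subseteq> I \<longleftrightarrow> Poly_Mapping.keys q \<subseteq> I"
      using q m by (auto simp: keys_plus_nat)
    moreover have "b n = 0" using True by (simp add: b_def)
    ultimately show ?thesis by (simp add: q on_vars_def d_def add.commute[of q m])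
  qed (simp add: b_def shift_eq_0)
  have "rational_gf k b"
    unfolding b_def using m slice by (rule rational_gf_boundary[where a = a and I = I])
  moreover have "rational_gf k (shift m d)"
    using diff unfolding d_def by (rule rational_gf_shift)
  ultimately have r: "rational_gf k (\<lambda>n. on_vars I a n - c * shift m (on_vars I a) n)"
    unfolding eq by (intro rational_gf_add)
  show ?thesis
  proof (cases "c = 0")
    case True
    then show ?thesis using r by simp
  next
    case False
    then have "c = 1" "m \<in> exponents k - {0}" using c m \<open>I \<subseteq> {..<k}\<close> by (auto simp: exponents_def)
    then show ?thesis using r by (rule_tac rational_gf_diff_op[of m]) (simp_all add: diff_op_def)
  qed
qed

text \<open>Closure under \<open>x + y - z\<close>, written additively because exponents have no
  negatives. Intersections of the orthant with cosets of subgroups have this property.\<close>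

definition affine_set :: "expo set \<Rightarrow> bool" where
  "affine_set S \<longleftrightarrow> (\<forall>x\<in>S. \<forall>y\<in>S. \<forall>z\<in>S. \<forall>w. x + y = z + w \<longrightarrow> w \<in> S)"

lemma affine_setD: "affine_set S \<Longrightarrow> x \<in> S \<Longrightarrow> y \<in> S \<Longrightarrow> z \<in> S \<Longrightarrow> x + y = z + w \<Longrightarrow> w \<in> S"
  unfolding affine_set_def by blast

lemma affine_set_UNIV [simp]: "affine_set UNIV"
  by (simp add: affine_set_def)

lemma affine_set_Int: "affine_set S \<Longrightarrow> affine_set T \<Longrightarrow> affine_set (S \<inter> T)"
  unfolding affine_set_def by blast

lemma affine_set_translate:
  assumes "affine_set S"
  shows "affine_set {n. n + m \<in> S}"
  unfolding affine_set_def
proof (intro ballI allI impI)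
  fix x y z w
  assume *: "x \<in> {n. n + m \<in> S}" "y \<in> {n. n + m \<in> S}" "z \<in> {n. n + m \<in> S}" "x + y = z + w"
  have "(x + m) + (y + m) = (x + y) + (m + m)" by (simp only: ac_simps)
  also have "\<dots> = (z + w) + (m + m)" by (simp only: *(4))
  also have "\<dots> = (z + m) + (w + m)" by (simp only: ac_simps)
  finally show "w \<in> {n. n + m \<in> S}" using affine_setD[OF assms, of "x + m" "y + m" "z + m" "w + m"] *(1-3) by simp
qed

text \<open>If \<open>S\<close> contains \<open>n0\<close> and \<open>n0 + m\<close> with
  \<open>m \<noteq> 0\<close>, then \<open>(x + m) + n0 = (n0 + m) + x\<close> shows that
  \<open>m\<close> is a period of \<open>S\<close> in both directions, and the recurrence with
  \<open>c = 1\<close> has zero right-hand side. Otherwise \<open>n0\<close> is the only point of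
  \<open>S\<close> in its translated orthant (within the variables \<open>I\<close>), and
  \<open>c = 0\<close> leaves a single coefficient.\<close>

lemma rational_gf_affine_set:
  assumes "finite I" "I \<subseteq> {..<k}" "affine_set S"
  shows "rational_gf k (on_vars I (indicator S))"
  using assms
proof (induction I arbitrary: S rule: finite_psubset_induct)
  case (psubset I)
  have slice: "rational_gf k (on_vars (I - {i}) (\<lambda>n. indicator S (n + m)))" if "i \<in> I" for i m
  proof -
    have "(\<lambda>n. indicator S (n + m)) = (indicator {n. n + m \<in> S} :: expo \<Rightarrow> int)"
      by (simp add: indicator_def fun_eq_iff)
    then show ?thesis
      using psubset.IH[OF _ _ affine_set_translate[OF psubset.prems(2)], of "I - {i}" m] that psubset.prems(1)
      by auto
  qed
  show ?case
  proof (cases "\<exists>n0\<in>S. Poly_Mapping.keys n0 \<subseteq> I")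
    case False
    then have "on_vars I (indicator S) = (\<lambda>_. 0)" by (auto simp: on_vars_def indicator_def fun_eq_iff)
    then show ?thesis by (simp add: rational_gf_zero)
  next
    case True
    then obtain n0 where n0: "n0 \<in> S" "Poly_Mapping.keys n0 \<subseteq> I" by auto
    show ?thesis
    proof (cases "\<exists>m. m \<noteq> 0 \<and> Poly_Mapping.keys m \<subseteq> I \<and> n0 + m \<in> S")
      case True
      then obtain m where m: "m \<noteq> 0" "Poly_Mapping.keys m \<subseteq> I" "n0 + m \<in> S" by auto
      have "x + m \<in> S \<longleftrightarrow> x \<in> S" for x
      proof
        assume "x + m \<in> S"
        then show "x \<in> S"
          using affine_setD[OF psubset.prems(2), of "x + m" n0 "n0 + m" x] n0 m by (simp add: ac_simps)
      next
        assume "x \<in> S"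
        then show "x + m \<in> S"
          using affine_setD[OF psubset.prems(2), of x "n0 + m" n0 "x + m"] n0 m by (simp add: ac_simps)
      qed
      then have "on_vars I (\<lambda>n. indicator S (n + m) - 1 * indicator S n) = (\<lambda>_. 0)"
        by (simp add: on_vars_def indicator_def fun_eq_iff)
      then have *: "rational_gf k (on_vars I (\<lambda>n. indicator S (n + m) - 1 * indicator S n))"
        by (simp only: rational_gf_zero)
      show ?thesis
        by (rule rational_gf_step[where a = "indicator S" and c = 1 and m = m])
          (use psubset.prems(1) m * slice in simp_all)
    next
      case False
      define b where "b = on_vars I (\<lambda>n. indicator S (n + n0) - 0 * indicator S n :: int)"
      have "n = 0" if "b n \<noteq> 0" for n
      proof -
        have "n0 + n \<in> S" "Poly_Mapping.keys n \<subseteq> I"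
          using that by (simp_all add: b_def on_vars_def indicator_def add.commute[of n0] split: if_splits)
        then show ?thesis using False by blast
      qed
      then have "{n. b n \<noteq> 0} \<subseteq> {0}" by blast
      then have "rational_gf k b" by (intro rational_gf_finite[of b]) (simp add: finite_subset)
      then show ?thesis
        by (rule_tac rational_gf_step[where a = "indicator S" and c = 0 and m = n0])
          (use psubset.prems(1) n0 slice b_def in simp_all)
    qed
  qed
qed

definition determined_by :: "expo set set \<Rightarrow> (expo \<Rightarrow> int) \<Rightarrow> bool" where
  "determined_by \<S> F \<longleftrightarrow> (\<forall>n n'. (\<forall>S\<in>\<S>. n \<in> S \<longleftrightarrow> n' \<in> S) \<longrightarrow> F n = F n')"

text \<open>Removing one set \<open>S\<close>, the function \<open>F\<close> coincides on
  \<open>S\<close> and on its complement with two functions determined by the remaining sets. The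
  complement of \<open>S\<close> need not be affine, so its part is obtained as the sum over
  \<open>T\<close> minus the sum over \<open>T \<inter> S\<close>; this is why \<open>T\<close> is
  kept general.\<close>

lemma rational_gf_determined_by:
  assumes "finite \<S>" "\<And>S. S \<in> \<S> \<Longrightarrow> affine_set S" "determined_by \<S> F" "affine_set T"
  shows "rational_gf k (\<lambda>n. on_vars {..<k} (indicator T) n * F n)"
  using assms
proof (induction \<S> arbitrary: F T rule: finite_induct)
  case empty
  then have F: "F n = F 0" for n by (auto simp: determined_by_def)
  have "rational_gf k (\<lambda>n. F 0 * on_vars {..<k} (indicator T) n)"
    using empty.prems by (intro rational_gf_cmult rational_gf_affine_set) auto
  moreover have "x * F n = F 0 * x" for x n
    using F[of n] by simp
  ultimately show ?case by (simp only:)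
next
  case (insert S \<S>)
  define same where "same n n' \<longleftrightarrow> (\<forall>S\<in>\<S>. n \<in> S \<longleftrightarrow> n' \<in> S)" for n n'
  \<comment> \<open>\<open>F1 U\<close> extends \<open>F\<close> from \<open>U\<close> to all
    exponents with the same membership pattern for the remaining sets. The value \<open>0\<close> is
    taken for patterns that do not occur in \<open>U\<close>.\<close>
  define F1 where "F1 U n = (if \<exists>n'\<in>U. same n n' then F (SOME n'. n' \<in> U \<and> same n n') else 0)" for U n
  have det: "determined_by \<S> (F1 U)" for U
  proof (unfold determined_by_def, intro allI impI)
    fix n n' assume "\<forall>S\<in>\<S>. n \<in> S \<longleftrightarrow> n' \<in> S"
    then have "same n = same n'" by (intro ext) (simp add: same_def)
    then show "F1 U n = F1 U n'" by (simp only: F1_def)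
  qed
  have F1: "F1 U n = F n" if "n \<in> U" "U = S \<or> U = - S" for n U
  proof -
    define n' where "n' = (SOME n'. n' \<in> U \<and> same n n')"
    have "n \<in> U \<and> same n n" using that by (simp add: same_def)
    then have "n' \<in> U \<and> same n n'" unfolding n'_def by (rule someI)
    moreover have "F1 U n = F n'" using \<open>n \<in> U \<and> same n n\<close> unfolding F1_def n'_def by (meson if_P)
    moreover have "F n = F n'"
    proof -
      have "\<forall>S'\<in>insert S \<S>. n \<in> S' \<longleftrightarrow> n' \<in> S'"
        using that \<open>n' \<in> U \<and> same n n'\<close> by (auto simp: same_def)
      then show ?thesis using insert.prems(2) by (simp add: determined_by_def)
    qed
    ultimately show ?thesis by simp
  qed
  have "on_vars {..<k} (indicator T) n * F n = on_vars {..<k} (indicator (T \<inter> S)) n * F1 S n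
    + (on_vars {..<k} (indicator T) n * F1 (- S) n
      - on_vars {..<k} (indicator (T \<inter> S)) n * F1 (- S) n)" for n
    using F1[of n S] F1[of n "- S"] by (auto simp: on_vars_def indicator_def)
  moreover have "rational_gf k (\<lambda>n. on_vars {..<k} (indicator (T \<inter> S)) n * F1 S n
    + (on_vars {..<k} (indicator T) n * F1 (- S) n
      - on_vars {..<k} (indicator (T \<inter> S)) n * F1 (- S) n))"
    by (rule rational_gf_add[OF insert.IH[OF _ det] rational_gf_diff[OF insert.IH[OF _ det] insert.IH[OF _ det]]])
      (simp_all add: affine_set_Int insert.prems)
  ultimately show ?case by (simp only:)
qed

section \<open>Linear forms and their positive parts\<close>

definition lin_form :: "nat \<Rightarrow> (nat \<Rightarrow> int) \<Rightarrow> expo \<Rightarrow> int" where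
  "lin_form k \<delta> n = (\<Sum>i<k. int (Poly_Mapping.lookup n i) * \<delta> i)"

lemma lin_form_add: "lin_form k \<delta> (n + m) = lin_form k \<delta> n + lin_form k \<delta> m"
  by (simp add: lin_form_def lookup_add algebra_simps sum.distrib)

lemma lin_form_single: "i < k \<Longrightarrow> lin_form k \<delta> (Poly_Mapping.single i N) = int N * \<delta> i"
proof -
  assume "i < k"
  have "lin_form k \<delta> (Poly_Mapping.single i N) = (\<Sum>j<k. if j = i then int N * \<delta> i else 0)"
    unfolding lin_form_def by (intro sum.cong) (auto simp: lookup_single when_def)
  then show ?thesis using \<open>i < k\<close> by simp
qed

lemma lin_form_mono:
  assumes "\<And>i. i \<in> Poly_Mapping.keys n \<Longrightarrow> \<delta> i \<le> \<epsilon> i"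
  shows "lin_form k \<delta> n \<le> lin_form k \<epsilon> n"
  unfolding lin_form_def
proof (rule sum_mono)
  fix i
  show "int (Poly_Mapping.lookup n i) * \<delta> i \<le> int (Poly_Mapping.lookup n i) * \<epsilon> i"
    using assms[of i] by (cases "i \<in> Poly_Mapping.keys n") (auto simp: mult_left_mono in_keys_iff)
qed

text \<open>A unit step in a live variable \<open>i\<close> changes the form by the constant
  \<open>\<delta> i\<close>, so the recurrence reduces to the indicator of a face.\<close>

lemma rational_gf_lin_form:
  assumes "finite I" "I \<subseteq> {..<k}"
  shows "rational_gf k (on_vars I (\<lambda>n. lin_form k \<delta> n + c))"
  using assms
proof (induction I arbitrary: c rule: finite_psubset_induct)
  case (psubset I)
  show ?case
  proof (cases "I = {}")
    case True
    then show ?thesis by (simp add: rational_gf_on_vars_empty)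
  next
    case False
    then obtain i where i: "i \<in> I" by auto
    have "rational_gf k (\<lambda>n. \<delta> i * on_vars I (indicator UNIV) n)"
      using psubset by (intro rational_gf_cmult rational_gf_affine_set) auto
    moreover have "on_vars I (\<lambda>n. (lin_form k \<delta> (n + Poly_Mapping.single i 1) + c)
        - 1 * (lin_form k \<delta> n + c)) = (\<lambda>n. \<delta> i * on_vars I (indicator UNIV) n)"
      using i psubset.prems by (auto simp: on_vars_def lin_form_add lin_form_single fun_eq_iff)
    ultimately have *: "rational_gf k (on_vars I (\<lambda>n. (lin_form k \<delta> (n + Poly_Mapping.single i 1) + c)
        - 1 * (lin_form k \<delta> n + c)))" by simp
    show ?thesis
    proof (rule rational_gf_step[where a = "\<lambda>n. lin_form k \<delta> n + c" and c = 1, OF psubset.prems(1) _ _ *])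
      fix j m assume "j \<in> I"
      then have "I - {j} \<subset> I" "I - {j} \<subseteq> {..<k}" using psubset.prems by auto
      from psubset.IH[OF this, of "lin_form k \<delta> m + c"]
      show "rational_gf k (on_vars (I - {j}) (\<lambda>n. lin_form k \<delta> (n + m) + c))"
        by (simp add: lin_form_add add.assoc)
    qed (use i in \<open>auto simp flip: keys_eq_empty\<close>)
  qed
qed

text \<open>Either the form vanishes at some nonzero exponent, which is then a period, or all
  coefficients on \<open>I\<close> have one sign with a strict one at \<open>i\<close>. In that
  case, far enough in direction \<open>i\<close>, the maximum is the affine form itself or
  constantly \<open>0\<close>.\<close>

lemma rational_gf_max_lin_form:
  assumes "finite I" "I \<subseteq> {..<k}"
  shows "rational_gf k (on_vars I (\<lambda>n. max 0 (lin_form k \<delta> n + c)))"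
  using assms
proof (induction I arbitrary: c rule: finite_psubset_induct)
  case (psubset I)
  let ?a = "\<lambda>n. max 0 (lin_form k \<delta> n + c)"
  have slice: "rational_gf k (on_vars (I - {j}) (\<lambda>n. ?a (n + m)))" if "j \<in> I" for j m
  proof -
    have "I - {j} \<subset> I" "I - {j} \<subseteq> {..<k}" using psubset.prems that by auto
    from psubset.IH[OF this, of "lin_form k \<delta> m + c"] show ?thesis
      by (simp add: lin_form_add add.assoc)
  qed
  have step: ?case if "Poly_Mapping.keys m \<subseteq> I" "d = 0 \<or> d = 1 \<and> m \<noteq> 0"
    "rational_gf k (on_vars I (\<lambda>n. ?a (n + m) - d * ?a n))" for m d
    by (rule rational_gf_step[where a = ?a, OF psubset.prems(1) that(1,2,3) slice])
  show ?case
  proof (cases "I = {}")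
    case True
    then show ?thesis by (simp add: rational_gf_on_vars_empty)
  next
    case False
    then obtain i where i: "i \<in> I" by auto
    then have ik: "i < k" using psubset.prems by auto
    \<comment> \<open>A distance of \<open>\<bar>c\<bar>\<close> suffices: as
      \<open>\<delta> i\<close> is a nonzero integer, the translation changes the form by at least
      \<open>\<bar>c\<bar>\<close> in absolute value, which absorbs the constant
      \<open>c\<close>.\<close>
    define N where "N = Poly_Mapping.single i (nat \<bar>c\<bar>)"
    have keys_N: "Poly_Mapping.keys N \<subseteq> I" using i by (simp add: N_def)
    have N: "lin_form k \<delta> N = \<bar>c\<bar> * \<delta> i" using ik by (simp add: N_def lin_form_single)
    consider m where "Poly_Mapping.keys m \<subseteq> I" "m \<noteq> 0" "lin_form k \<delta> m = 0"
      | "\<forall>j\<in>I. 0 \<le> \<delta> j" "0 < \<delta> i" | "\<forall>j\<in>I. \<delta> j \<le> 0" "\<delta> i < 0"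
    proof (cases "\<exists>j\<in>I. \<exists>j'\<in>I. 0 < \<delta> j \<and> \<delta> j' < 0")
      case True
      then obtain j j' where j: "j \<in> I" "j' \<in> I" "0 < \<delta> j" "\<delta> j' < 0" by auto
      \<comment> \<open>The weights are crossed so that the two contributions are
        \<open>- \<delta> j' * \<delta> j\<close> and \<open>\<delta> j * \<delta> j'\<close>, which
        cancel.\<close>
      define m where "m = Poly_Mapping.single j (nat (- \<delta> j')) + Poly_Mapping.single j' (nat (\<delta> j))"
      have "j < k" "j' < k" using j psubset.prems by auto
      then have "lin_form k \<delta> m = 0"
        using j by (simp add: m_def lin_form_add lin_form_single)
      moreover have "Poly_Mapping.keys m = {j, j'}" using j by (simp add: m_def keys_plus_nat insert_commute)
      moreover from this have "m \<noteq> 0" by (metis insert_not_empty keys_zero)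
      ultimately show thesis using that(1)[of m] j by auto
    next
      case no: False
      show thesis
      proof (cases "\<delta> i = 0")
        case True
        moreover have "Poly_Mapping.single i 1 \<noteq> (0 :: expo)"
          by (metis keys_single insert_not_empty keys_zero zero_neq_one)
        ultimately show thesis using that(1)[of "Poly_Mapping.single i 1"] i ik
          by (simp add: lin_form_single)
      next
        case False
        then show thesis using no that(2,3) i by (metis linorder_neqE_linordered_idom not_le)
      qed
    qed
    then show ?thesis
    proof cases
      case (1 m)
      then show ?thesis by (intro step[of m 1]) (simp_all add: lin_form_add on_vars_def[abs_def] rational_gf_zero)
    next
      case 2
      have "0 \<le> lin_form k \<delta> n" if "Poly_Mapping.keys n \<subseteq> I" for n
      proof -
        have "lin_form k (\<lambda>_. 0) n \<le> lin_form k \<delta> n" using that 2(1) by (intro lin_form_mono) blast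
        then show ?thesis by (simp add: lin_form_def)
      qed
      moreover have "\<bar>c\<bar> \<le> \<bar>c\<bar> * \<delta> i" using 2 by (simp add: mult_le_cancel_left1)
      ultimately have "on_vars I (\<lambda>n. ?a (n + N) - 0 * ?a n) = on_vars I (\<lambda>n. lin_form k \<delta> n + (\<bar>c\<bar> * \<delta> i + c))"
        by (fastforce simp: on_vars_def lin_form_add N fun_eq_iff)
      then show ?thesis using psubset.hyps psubset.prems
        by (intro step[OF keys_N, of 0]) (auto intro: rational_gf_lin_form)
    next
      case 3
      have "lin_form k \<delta> n \<le> 0" if "Poly_Mapping.keys n \<subseteq> I" for n
      proof -
        have "lin_form k \<delta> n \<le> lin_form k (\<lambda>_. 0) n" using that 3(1) by (intro lin_form_mono) blast
        then show ?thesis by (simp add: lin_form_def)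
      qed
      moreover have "\<bar>c\<bar> * \<delta> i \<le> \<bar>c\<bar> * (-1)" using 3 by (intro mult_left_mono) auto
      ultimately have "on_vars I (\<lambda>n. ?a (n + N) - 0 * ?a n) = (\<lambda>_. 0)"
        by (fastforce simp: on_vars_def lin_form_add N fun_eq_iff)
      then show ?thesis by (intro step[OF keys_N, of 0]) (auto simp: rational_gf_zero)
    qed
  qed
qed

subsection \<open>Evaluation\<close>

lemma monomial_at_add: "monomial_at k z (m + n) = monomial_at k z m * monomial_at k z n"
  by (simp add: monomial_at_def lookup_add power_add prod.distrib)

lemma poly_at_superset:
  assumes "finite S" "Poly_Mapping.keys f \<subseteq> S"
  shows "poly_at k z f = (\<Sum>n\<in>S. of_int (Poly_Mapping.lookup f n) * monomial_at k z n)"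
  unfolding poly_at_def using assms by (intro sum.mono_neutral_left) (auto simp: in_keys_iff)

lemma poly_at_add: "poly_at k z (f + g) = poly_at k z f + poly_at k z g"
proof -
  let ?S = "Poly_Mapping.keys f \<union> Poly_Mapping.keys g"
  have "Poly_Mapping.keys (f + g) \<subseteq> ?S" by (rule keys_add)
  then show ?thesis
    by (simp add: poly_at_superset[of ?S] lookup_add algebra_simps sum.distrib)
qed

lemma poly_at_zero [simp]: "poly_at k z 0 = 0"
  by (simp add: poly_at_def)

lemma poly_at_sum: "finite S \<Longrightarrow> poly_at k z (\<Sum>x\<in>S. f x) = (\<Sum>x\<in>S. poly_at k z (f x))"
  by (induction S rule: finite_induct) (auto simp: poly_at_add)

lemma poly_at_single: "poly_at k z (Poly_Mapping.single n c) = of_int c * monomial_at k z n"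
  by (simp add: poly_at_superset[of "{n}"])

lemma poly_mapping_sum_single:
  "(\<Sum>n\<in>Poly_Mapping.keys f. Poly_Mapping.single n (Poly_Mapping.lookup f n)) = f"
  by (intro poly_mapping_eqI)
    (auto simp: lookup_sum lookup_single when_def sum.If_cases in_keys_iff)

lemma poly_at_mult_single:
  "poly_at k z (f * Poly_Mapping.single m c) = poly_at k z f * (of_int c * monomial_at k z m)"
proof -
  have "f * Poly_Mapping.single m c =
    (\<Sum>n\<in>Poly_Mapping.keys f. Poly_Mapping.single n (Poly_Mapping.lookup f n) * Poly_Mapping.single m c)"
    by (subst (1) poly_mapping_sum_single[of f, symmetric]) (simp add: sum_distrib_right)
  then have "poly_at k z (f * Poly_Mapping.single m c) = (\<Sum>n\<in>Poly_Mapping.keys f.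
      (of_int (Poly_Mapping.lookup f n) * monomial_at k z n) * (of_int c * monomial_at k z m))"
    by (simp add: poly_at_sum mult_single poly_at_single monomial_at_add ac_simps)
  then show ?thesis by (simp add: poly_at_def sum_distrib_right)
qed

text \<open>The factor \<open>1 - z^m\<close> is a nonzero polynomial because
  \<open>m \<noteq> 0\<close> leaves its constant coefficient at \<open>1\<close>; the product stays
  nonzero since the polynomial ring is an integral domain.\<close>

lemma int_polys_mult_diff_op_factor:
  assumes "h \<in> int_polys k" "m \<in> exponents k - {0}" "h \<noteq> 0"
  obtains h' where "h' \<in> int_polys k" "h' \<noteq> 0"
    "\<And>z. poly_at k z h' = (1 - monomial_at k z m) * poly_at k z h"
proof
  let ?h = "h * (1 + Poly_Mapping.single m (- 1))"
  have "Poly_Mapping.lookup (1 + Poly_Mapping.single m (- 1)) 0 = (1 :: int)"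
    using assms by (simp add: lookup_add lookup_single)
  then have "1 + Poly_Mapping.single m (- 1) \<noteq> (0 :: (nat \<Rightarrow>\<^sub>0 nat) \<Rightarrow>\<^sub>0 int)"
    by (metis lookup_zero zero_neq_one)
  then show "?h \<noteq> 0" using assms by simp
  have "Poly_Mapping.keys ?h \<subseteq> {x + y |x y. x \<in> Poly_Mapping.keys h \<and>
      y \<in> Poly_Mapping.keys (1 + Poly_Mapping.single m (- 1) :: (nat \<Rightarrow>\<^sub>0 nat) \<Rightarrow>\<^sub>0 int)}"
    using keys_mult by blast
  moreover have "Poly_Mapping.keys (1 + Poly_Mapping.single m (- 1) :: (nat \<Rightarrow>\<^sub>0 nat) \<Rightarrow>\<^sub>0 int) \<subseteq> {0, m}"
    using keys_add[of 1 "Poly_Mapping.single m (- 1 :: int)"] by auto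
  ultimately show "?h \<in> int_polys k"
    using assms by (fastforce simp: int_polys_def exponents_def keys_plus_nat)
  show "poly_at k z ?h = (1 - monomial_at k z m) * poly_at k z h" for z
    by (simp add: distrib_left poly_at_add poly_at_mult_single algebra_simps)
qed

text \<open>Translation by \<open>m\<close> reindexes the series, so the shifted series sums to
  \<open>monomial_at k z m * S\<close>; its terms outside the translated orthant are zero.\<close>

lemma has_sum_diff_op:
  assumes "m \<in> exponents k"
    and "((\<lambda>n. of_int (a n) * monomial_at k z n) has_sum S) (exponents k)"
  shows "((\<lambda>n. of_int (diff_op m a n) * monomial_at k z n) has_sum (1 - monomial_at k z m) * S) (exponents k)"
proof -
  let ?f = "\<lambda>n. of_int (shift m a n) * monomial_at k z n"
  have "((\<lambda>n. monomial_at k z m * (of_int (a n) * monomial_at k z n)) has_sum monomial_at k z m * S) (exponents k)"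
    by (rule has_sum_cmult_right[OF assms(2)])
  then have "((?f \<circ> (+) m) has_sum monomial_at k z m * S) (exponents k)"
    by (simp add: o_def monomial_at_add algebra_simps)
  then have "(?f has_sum monomial_at k z m * S) ((+) m ` exponents k)"
    by (subst has_sum_reindex) auto
  also have "?this \<longleftrightarrow> (?f has_sum monomial_at k z m * S) (exponents k)"
  proof (rule has_sum_cong_neutral)
    fix n assume n: "n \<in> exponents k - (+) m ` exponents k"
    have "\<nexists>q. n = m + q" using n by (auto simp: exponents_def keys_plus_nat)
    then show "?f n = 0" by (simp add: shift_eq_0)
  qed (use assms(1) in \<open>auto simp: exponents_def keys_plus_nat\<close>)
  finally have "((\<lambda>n. of_int (a n) * monomial_at k z n + - ?f n) has_sum (S + - (monomial_at k z m * S))) (exponents k)"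
    using assms(2) by (intro has_sum_add) (simp_all add: has_sum_uminus)
  then show ?thesis by (simp add: diff_op_def algebra_simps)
qed

text \<open>The pair \<open>f\<close>, \<open>h\<close> is independent of \<open>z\<close>:
  \<open>h\<close> is the product of the factors \<open>1 - z^m\<close>, and \<open>f\<close>
  collects the finitely many coefficients left after clearing them. Avoiding division, the identity
  also covers the zeros of \<open>h\<close>.\<close>

lemma rational_gf_eval:
  assumes "rational_gf k a" "\<And>n. n \<notin> exponents k \<Longrightarrow> a n = 0"
  shows "\<exists>f\<in>int_polys k. \<exists>h\<in>int_polys k. h \<noteq> 0 \<and> (\<forall>z S.
    ((\<lambda>n. of_int (a n) * monomial_at k z n) has_sum S) (exponents k) \<longrightarrow>
      poly_at k z h * S = poly_at k z f)"
proof -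
  obtain ms where "set ms \<subseteq> exponents k - {0}" "finite {n. fold diff_op ms a n \<noteq> 0}"
    using assms(1) unfolding rational_gf_def by blast
  then show ?thesis using assms(2)
  proof (induction ms arbitrary: a)
    case Nil
    let ?f = "Abs_poly_mapping a"
    have look: "Poly_Mapping.lookup ?f = a" using Nil by simp
    have "Poly_Mapping.keys ?f \<subseteq> exponents k"
      using Nil.prems(3) look by (metis in_keys_iff subsetI)
    moreover have "poly_at k z ?f = S"
      if "((\<lambda>n. of_int (a n) * monomial_at k z n) has_sum S) (exponents k)" for z S
    proof -
      have "((\<lambda>n. of_int (a n) * monomial_at k z n) has_sum S) (Poly_Mapping.keys ?f)"
        using \<open>Poly_Mapping.keys ?f \<subseteq> _\<close>
        by (subst has_sum_cong_neutral[OF _ _ refl, where T = "exponents k"])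
          (auto simp: in_keys_iff look that)
      then show ?thesis unfolding poly_at_def look by (simp add: has_sum_finite_iff)
    qed
    moreover have "1 \<in> int_polys k" by (simp add: int_polys_def exponents_def)
    moreover have "poly_at k z 1 = 1" for z
      using poly_at_single[of k z 0 1] by (simp add: monomial_at_def)
    ultimately show ?case by (intro bexI[of _ ?f] bexI[of _ 1]) (auto simp: int_polys_def)
  next
    case (Cons m ms)
    have m: "m \<in> exponents k - {0}" using Cons.prems by auto
    have "diff_op m a n = 0" if "n \<notin> exponents k" for n
    proof -
      have "shift m a n = 0"
      proof (cases "\<exists>q. n = m + q")
        case True
        then obtain q where "n = m + q" by auto
        then show ?thesis using that m Cons.prems(3) by (auto simp: exponents_def keys_plus_nat)
      qed (rule shift_eq_0)
      then show ?thesis using that Cons.prems by (simp add: diff_op_def)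
    qed
    then obtain f h where f: "f \<in> int_polys k" and h: "h \<in> int_polys k" "h \<noteq> 0" and
      fh: "\<And>z S. ((\<lambda>n. of_int (diff_op m a n) * monomial_at k z n) has_sum S) (exponents k) \<Longrightarrow>
        poly_at k z h * S = poly_at k z f"
      using Cons.IH[of "diff_op m a"] Cons.prems(1,2) by force
    obtain h' where h': "h' \<in> int_polys k" "h' \<noteq> 0"
      "\<And>z. poly_at k z h' = (1 - monomial_at k z m) * poly_at k z h"
      using int_polys_mult_diff_op_factor[OF h(1) m h(2)] by blast
    show ?case
    proof (rule bexI[OF _ f], rule bexI[OF _ h'(1)], intro conjI allI impI)
      fix z S assume "((\<lambda>n. of_int (a n) * monomial_at k z n) has_sum S) (exponents k)"
      then have "poly_at k z h * ((1 - monomial_at k z m) * S) = poly_at k z f"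
        using m by (intro fh has_sum_diff_op) auto
      then show "poly_at k z h' * S = poly_at k z f" by (simp add: h'(3) ac_simps)
    qed (rule h')
  qed
qed

section \<open>Effective classes and rank in the Jacobian\<close>

text \<open>Each congruence class is countable, so finitely many of them cannot cover the reals.
  This is the source of all generic coordinates below.\<close>

lemma not_rcong_finite:
  assumes "finite A"
  shows "\<exists>x. \<forall>a\<in>A. \<not> [x = a] (rmod L)"
proof -
  have "countable (\<Union>a\<in>A. range (\<lambda>n::int. a + of_int n * L))"
    using assms by (simp add: countable_finite)
  then obtain x where x: "x \<notin> (\<Union>a\<in>A. range (\<lambda>n::int. a + of_int n * L))"
    using uncountable_UNIV_real by (metis UNIV_eq_I)
  have "\<not> [x = a] (rmod L)" if "a \<in> A" for a
  proof
    assume "[x = a] (rmod L)"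
    then have "[a = x] (rmod L)" by (rule rcong_sym)
    then obtain n where "x = a + of_int n * L" unfolding rcong_altdef by blast
    then show False using x that by blast
  qed
  then show ?thesis by blast
qed

lemma rcong_diff_swap: "[x - y = z] (rmod L) \<longleftrightarrow> [y = x - z] (rmod L)"
proof -
  have "[x - y = z] (rmod L) \<longleftrightarrow> [x - y + (y - z) = z + (y - z)] (rmod L)"
    by (rule rcong_add_right_cancel[symmetric])
  then show ?thesis by (simp add: rcong_sym_iff)
qed

lemma rcong_cong_left: "[x = y] (rmod L) \<Longrightarrow> [x = z] (rmod L) \<longleftrightarrow> [y = z] (rmod L)"
  by (simp only: rcong_def)

text \<open>
  The Picard group of a chain of loops is \<open>\<int> \<times> (\<Prod>i. \<real> / l i \<int>)\<close>. A class is encoded by its degree \<open>d\<close>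
  and by representatives \<open>c i\<close> of its torus coordinates. It is effective iff it contains a sum of
  points, \<open>e i\<close> of them on the \<open>i\<close>-th loop; seen from the \<open>i\<close>-th loop, the points further left
  sit at \<open>v i\<close> and those further right at \<open>w i\<close>. The points on the loop itself can realise every
  value of the coordinate, unless there are none.
\<close>

locale loop_lengths =
  fixes g :: nat and l v w :: "nat \<Rightarrow> real"
  assumes g_pos: "1 \<le> g"
begin

definition eff_class :: "int \<Rightarrow> (nat \<Rightarrow> real) \<Rightarrow> bool" where
  "eff_class d c \<longleftrightarrow> (\<exists>e::nat \<Rightarrow> nat. int (\<Sum>i\<in>{1..g}. e i) = d \<and>
     (\<forall>i\<in>{1..g}. e i = 0 \<longrightarrow>
        [c i = real (\<Sum>j\<in>{1..<i}. e j) * v i + (of_int d - real (\<Sum>j\<in>{1..<i}. e j)) * w i] (rmod l i)))"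

text \<open>Two classes have the same type over the constants \<open>A\<close>: no comparison of a
  coordinate with one of them tells the classes apart.\<close>

definition same_on :: "(nat \<Rightarrow> real set) \<Rightarrow> (nat \<Rightarrow> real) \<Rightarrow> (nat \<Rightarrow> real) \<Rightarrow> bool" where
  "same_on A c c' \<longleftrightarrow> (\<forall>i\<in>{1..g}. \<forall>a\<in>A i. [c i = a] (rmod l i) \<longleftrightarrow> [c' i = a] (rmod l i))"

text \<open>The constants with which \<open>eff_class d\<close> can compare the \<open>i\<close>-th
  coordinate; \<open>a\<close> is the number of points to the left of the loop.\<close>

definition eff_atoms :: "int \<Rightarrow> nat \<Rightarrow> real set" where
  "eff_atoms d i = (\<lambda>a. real a * v i + (of_int d - real a) * w i) ` {..nat d}"

definition class_rank_ge :: "int \<Rightarrow> (nat \<Rightarrow> real) \<Rightarrow> nat \<Rightarrow> bool" where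
  "class_rank_ge d c r \<longleftrightarrow> (\<forall>c'. eff_class (int r) c' \<longrightarrow> eff_class (d - int r) (\<lambda>i. c i - c' i))"

definition class_rank :: "int \<Rightarrow> (nat \<Rightarrow> real) \<Rightarrow> int" where
  "class_rank d c = (if eff_class d c then int (GREATEST r. class_rank_ge d c r) else -1)"

text \<open>What must be known about \<open>c\<close> in order to split it as \<open>e\<close> plus
  \<open>c - e\<close> with prescribed types over \<open>A\<close> and \<open>B\<close>: if
  \<open>e i\<close> equals \<open>a\<close>, then \<open>c i - e i\<close> equals \<open>b\<close>
  exactly when \<open>c i\<close> equals \<open>a + b\<close>.\<close>

definition sum_atoms :: "(nat \<Rightarrow> real set) \<Rightarrow> (nat \<Rightarrow> real set) \<Rightarrow> nat \<Rightarrow> real set" where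
  "sum_atoms A B i = (\<lambda>(a, b). a + b) ` (A i \<times> B i)"

text \<open>The first part decides effectiveness, the others the condition of rank at least
  \<open>r\<close>. The range of \<open>r\<close> is bounded because that condition forces
  \<open>int r \<le> d\<close>.\<close>

definition rank_atoms :: "int \<Rightarrow> nat \<Rightarrow> real set" where
  "rank_atoms d i =
     eff_atoms d i \<union> (\<Union>r\<le>nat d. sum_atoms (eff_atoms (int r)) (eff_atoms (d - int r)) i)"

section \<open>Effectiveness and rank depend only on types\<close>

lemma same_on_sym: "same_on A c c' \<Longrightarrow> same_on A c' c"
  by (simp add: same_on_def)

lemma same_on_mono: "same_on B c c' \<Longrightarrow> (\<And>i. A i \<subseteq> B i) \<Longrightarrow> same_on A c c'"
  unfolding same_on_def by blast

lemma finite_eff_atoms: "finite (eff_atoms d i)"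
  by (simp add: eff_atoms_def)

lemma finite_rank_atoms: "finite (rank_atoms d i)"
  by (simp add: rank_atoms_def sum_atoms_def finite_eff_atoms)

lemma eff_class_nonneg: "eff_class d c \<Longrightarrow> 0 \<le> d"
  unfolding eff_class_def using of_nat_0_le_iff by blast

lemma mem_eff_atoms:
  assumes "int (\<Sum>i\<in>{1..g}. e i) = d" "i \<in> {1..g}"
  shows "real (\<Sum>j\<in>{1..<i}. e j) * v i + (of_int d - real (\<Sum>j\<in>{1..<i}. e j)) * w i \<in> eff_atoms d i"
proof -
  have "(\<Sum>j\<in>{1..<i}. e j) \<le> (\<Sum>i\<in>{1..g}. e i)"
    using assms(2) by (intro sum_mono2) auto
  also have "\<dots> = nat d" using assms(1) by linarith
  finally show ?thesis unfolding eff_atoms_def by (intro image_eqI[OF refl]) simp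
qed

lemma eff_class_cong:
  assumes "same_on (eff_atoms d) c c'" "eff_class d c"
  shows "eff_class d c'"
proof -
  obtain e :: "nat \<Rightarrow> nat" where e: "int (\<Sum>i\<in>{1..g}. e i) = d"
    "\<forall>i\<in>{1..g}. e i = 0 \<longrightarrow>
        [c i = real (\<Sum>j\<in>{1..<i}. e j) * v i + (of_int d - real (\<Sum>j\<in>{1..<i}. e j)) * w i] (rmod l i)"
    using assms(2) unfolding eff_class_def by blast
  then show ?thesis
    using assms(1) mem_eff_atoms[OF e(1)] unfolding eff_class_def same_on_def by blast
qed

text \<open>
  The back-and-forth step: the circles are infinite, so the value \<open>e i\<close> can avoid finitely many points.
\<close>

lemma same_on_extend:
  assumes "\<And>i. finite (A i)" "\<And>i. finite (B i)" "same_on (sum_atoms A B) c c'"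
  obtains e where "same_on A e e'" "same_on B (\<lambda>i. c i - e i) (\<lambda>i. c' i - e' i)"
proof -
  have "\<exists>x. (\<forall>a\<in>A i. [x = a] (rmod l i) \<longleftrightarrow> [e' i = a] (rmod l i)) \<and>
          (\<forall>b\<in>B i. [c i - x = b] (rmod l i) \<longleftrightarrow> [c' i - e' i = b] (rmod l i))" if i: "i \<in> {1..g}" for i
  proof -
    have same: "[c i = a + b] (rmod l i) \<longleftrightarrow> [c' i = a + b] (rmod l i)" if "a \<in> A i" "b \<in> B i" for a b
      using assms(3) i that unfolding same_on_def sum_atoms_def by blast
    have shift: "[y - x = b] (rmod l i) \<longleftrightarrow> [y = a + b] (rmod l i)" if "[x = a] (rmod l i)" for x y a b
    proof -
      have "[y - x = y - a] (rmod l i)" using that by simp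
      then have "[y - x = b] (rmod l i) \<longleftrightarrow> [y - a = b] (rmod l i)" by (rule rcong_cong_left)
      also have "\<dots> \<longleftrightarrow> [y - a + a = b + a] (rmod l i)" by (rule rcong_add_right_cancel[symmetric])
      finally show ?thesis by (simp add: add.commute)
    qed
    \<comment> \<open>An equality of \<open>e' i\<close> or of \<open>c' i - e' i\<close> with a
      constant forces the choice, to \<open>e' i\<close> or to \<open>c i - b\<close> respectively,
      and \<open>same\<close> makes it consistent with all other comparisons. Without such an
      equality a generic value is taken.\<close>
    consider (A) a where "a \<in> A i" "[e' i = a] (rmod l i)"
      | (B) b where "b \<in> B i" "[c' i - e' i = b] (rmod l i)"
      | (none) "\<forall>a\<in>A i. \<not> [e' i = a] (rmod l i)" "\<forall>b\<in>B i. \<not> [c' i - e' i = b] (rmod l i)"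
      by blast
    then show ?thesis
    proof cases
      case A
      have "[c i - e' i = b] (rmod l i) \<longleftrightarrow> [c' i - e' i = b] (rmod l i)" if "b \<in> B i" for b
        using shift[OF A(2)] same[OF A(1) that] by simp
      then show ?thesis by (intro exI[of _ "e' i"]) auto
    next
      case B
      have "[c i - b = a] (rmod l i) \<longleftrightarrow> [e' i = a] (rmod l i)" if "a \<in> A i" for a
      proof -
        have "[e' i = c' i - b] (rmod l i)" using B(2) by (simp only: rcong_diff_swap)
        then have "[e' i = a] (rmod l i) \<longleftrightarrow> [c' i - b = a] (rmod l i)" by (rule rcong_cong_left)
        also have "\<dots> \<longleftrightarrow> [c' i = b + a] (rmod l i)" by (rule shift) simp
        also have "\<dots> \<longleftrightarrow> [c i = b + a] (rmod l i)"
          using same[OF that B(1)] by (simp add: add.commute)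
        also have "\<dots> \<longleftrightarrow> [c i - b = a] (rmod l i)" by (rule shift[symmetric]) simp
        finally show ?thesis by simp
      qed
      moreover have "[c i - (c i - b) = b'] (rmod l i) \<longleftrightarrow> [c' i - e' i = b'] (rmod l i)" for b'
        using rcong_cong_left[OF B(2), of b'] by simp
      ultimately show ?thesis by (intro exI[of _ "c i - b"]) auto
    next
      case none
      have "finite (A i \<union> (\<lambda>b. c i - b) ` B i)" using assms by auto
      then obtain x where x: "\<forall>a\<in>A i \<union> (\<lambda>b. c i - b) ` B i. \<not> [x = a] (rmod l i)"
        using not_rcong_finite by blast
      then have "\<forall>b\<in>B i. \<not> [c i - x = b] (rmod l i)" by (auto simp: rcong_diff_swap)
      then show ?thesis using x none by blast
    qed
  qed
  then obtain e where "\<And>i. i \<in> {1..g} \<Longrightarrow> (\<forall>a\<in>A i. [e i = a] (rmod l i) \<longleftrightarrow> [e' i = a] (rmod l i)) \<and>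
          (\<forall>b\<in>B i. [c i - e i = b] (rmod l i) \<longleftrightarrow> [c' i - e' i = b] (rmod l i))"
    by metis
  then show ?thesis by (intro that[of e]) (auto simp: same_on_def)
qed

text \<open>All points are put on the first loop. This keeps the quantifier in
  \<open>class_rank_ge\<close> from being vacuous and thereby bounds the rank by the degree.\<close>

lemma eff_class_exists: "\<exists>c. eff_class (int d) c"
proof -
  define e where "e i = (if i = 1 then d else 0)" for i :: nat
  have "(\<Sum>i\<in>{1..g}. e i) = d" using g_pos by (simp add: e_def)
  then have "eff_class (int d)
      (\<lambda>i. real (\<Sum>j\<in>{1..<i}. e j) * v i + (of_int (int d) - real (\<Sum>j\<in>{1..<i}. e j)) * w i)"
    unfolding eff_class_def by (intro exI[of _ e]) simp
  then show ?thesis by blast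
qed

text \<open>One point on every loop frees every coordinate; the surplus of \<open>nat d - g\<close>
  points goes to the first loop.\<close>

lemma eff_class_large:
  assumes "int g \<le> d"
  shows "eff_class d c"
proof -
  define e where "e i = (if i = 1 then nat d - g + 1 else 1)" for i :: nat
  have "(\<Sum>i\<in>{1..g}. e i) = (\<Sum>i\<in>{1..g}. (if i = 1 then nat d - g else 0) + 1)"
    by (intro sum.cong) (auto simp: e_def)
  also have "\<dots> = (\<Sum>i\<in>{1..g}. if i = 1 then nat d - g else 0) + g" by (subst sum.distrib) simp
  also have "\<dots> = nat d" using g_pos assms by simp
  finally have "int (\<Sum>i\<in>{1..g}. e i) = d" using assms by simp
  then show ?thesis unfolding eff_class_def by (intro exI[of _ e]) (simp add: e_def)
qed

text \<open>With fewer than \<open>g\<close> points some loop is empty, which ties its coordinate to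
  one of finitely many constants. A class avoiding all of them is not effective.\<close>

lemma eff_class_small:
  assumes "d < int g"
  shows "\<exists>c. \<not> eff_class d c"
proof -
  have "\<forall>i. \<exists>x. \<forall>a\<in>eff_atoms d i. \<not> [x = a] (rmod l i)"
    by (intro allI not_rcong_finite finite_eff_atoms)
  from choice[OF this] obtain c where c: "\<And>i. \<forall>a\<in>eff_atoms d i. \<not> [c i = a] (rmod l i)" by blast
  have "\<not> eff_class d c"
  proof
    assume "eff_class d c"
    then obtain e :: "nat \<Rightarrow> nat" where e: "int (\<Sum>i\<in>{1..g}. e i) = d"
      "\<forall>i\<in>{1..g}. e i = 0 \<longrightarrow>
          [c i = real (\<Sum>j\<in>{1..<i}. e j) * v i + (of_int d - real (\<Sum>j\<in>{1..<i}. e j)) * w i] (rmod l i)"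
      unfolding eff_class_def by blast
    have "\<exists>i\<in>{1..g}. e i = 0"
    proof (rule ccontr)
      assume "\<not> (\<exists>i\<in>{1..g}. e i = 0)"
      then have "(\<Sum>i\<in>{1..g}. 1) \<le> (\<Sum>i\<in>{1..g}. e i)" by (intro sum_mono) (simp add: Suc_le_eq)
      then have "g \<le> (\<Sum>i\<in>{1..g}. e i)" by simp
      then show False using e(1) assms by linarith
    qed
    then obtain i where i: "i \<in> {1..g}" "e i = 0" by blast
    then show False using c e(2) mem_eff_atoms[OF e(1) i(1)] by blast
  qed
  then show ?thesis by blast
qed

lemma class_rank_ge_le:
  assumes "class_rank_ge d c r"
  shows "int r \<le> d"
proof -
  obtain c' where "eff_class (int r) c'" using eff_class_exists by blast
  then have "eff_class (d - int r) (\<lambda>i. c i - c' i)" using assms unfolding class_rank_ge_def by blast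
  then show ?thesis using eff_class_nonneg by fastforce
qed

text \<open>A challenge \<open>e'\<close> against \<open>c'\<close> is carried back to a challenge
  \<open>e\<close> of the same type against \<open>c\<close>; the answer for \<open>c\<close> then
  transfers to \<open>c'\<close>.\<close>

lemma class_rank_ge_cong:
  assumes "same_on (rank_atoms d) c c'" "class_rank_ge d c r"
  shows "class_rank_ge d c' r"
  unfolding class_rank_ge_def
proof (intro allI impI)
  fix e' assume e': "eff_class (int r) e'"
  have "r \<le> nat d" using class_rank_ge_le[OF assms(2)] by linarith
  then have "same_on (sum_atoms (eff_atoms (int r)) (eff_atoms (d - int r))) c c'"
    by (intro same_on_mono[OF assms(1)]) (auto simp: rank_atoms_def)
  then obtain e where e: "same_on (eff_atoms (int r)) e e'"
    "same_on (eff_atoms (d - int r)) (\<lambda>i. c i - e i) (\<lambda>i. c' i - e' i)"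
    by (rule same_on_extend[OF finite_eff_atoms finite_eff_atoms])
  have "eff_class (int r) e" using eff_class_cong[OF same_on_sym[OF e(1)] e'] .
  then have "eff_class (d - int r) (\<lambda>i. c i - e i)"
    using assms(2) by (simp add: class_rank_ge_def)
  then show "eff_class (d - int r) (\<lambda>i. c' i - e' i)" by (rule eff_class_cong[OF e(2)])
qed

lemma class_rank_cong:
  assumes "same_on (rank_atoms d) c c'"
  shows "class_rank d c = class_rank d c'"
proof -
  have "same_on (eff_atoms d) c c'"
    using assms by (rule same_on_mono) (auto simp: rank_atoms_def)
  then have "eff_class d c = eff_class d c'" using eff_class_cong same_on_sym by blast
  moreover have "class_rank_ge d c = class_rank_ge d c'"
    using assms class_rank_ge_cong same_on_sym by blast
  ultimately show ?thesis by (simp add: class_rank_def)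
qed

lemma class_rank_neg: "d < 0 \<Longrightarrow> class_rank d c = -1"
  using eff_class_nonneg[of d c] by (auto simp: class_rank_def)

text \<open>For \<open>r = d - g\<close> the difference still has degree \<open>g\<close>, so it is
  effective. For larger \<open>r\<close> there is a class \<open>c'\<close> of degree
  \<open>d - r < g\<close> that is not effective, and \<open>c - c'\<close> is the obstructing
  challenge: it is effective because \<open>r \<ge> d - g + 1 \<ge> g\<close>, which is where
  \<open>2 g - 1\<close> comes from.\<close>

lemma class_rank_large:
  assumes "2 * int g - 1 \<le> d"
  shows "class_rank d c = d - int g"
proof -
  have "(GREATEST r. class_rank_ge d c r) = nat (d - int g)"
  proof (rule Greatest_equality)
    show "class_rank_ge d c (nat (d - int g))"
      using assms g_pos unfolding class_rank_ge_def by (auto intro: eff_class_large)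
  next
    fix r assume r: "class_rank_ge d c r"
    show "r \<le> nat (d - int g)"
    proof (rule ccontr)
      assume "\<not> ?thesis"
      then have "d - int r < int g" "int g \<le> int r" using assms by linarith+
      then obtain c' where c': "\<not> eff_class (d - int r) c'" using eff_class_small by blast
      have "eff_class (d - int r) (\<lambda>i. c i - (c i - c' i))"
        using r eff_class_large[OF \<open>int g \<le> int r\<close>, of "\<lambda>i. c i - c' i"]
        unfolding class_rank_ge_def by blast
      then show False using c' by simp
    qed
  qed
  then show ?thesis using assms g_pos by (simp add: class_rank_def eff_class_large)
qed

end

section \<open>Piecewise linear functions on a segment\<close>

text \<open>The function that vanishes to the left of the support of \<open>q\<close> and whose
  slope increases by \<open>q u\<close> at \<open>u\<close>.\<close>

definition ramp :: "(real \<Rightarrow> int) \<Rightarrow> real \<Rightarrow> real" where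
  "ramp q t = (\<Sum>u | q u \<noteq> 0. of_int (q u) * max 0 (t - u))"

text \<open>
  Up to constants, the piecewise linear functions on \<open>{0..L}\<close> correspond to their charges: the sum
  \<open>q u\<close> of the outgoing slopes at each \<open>u\<close>. This includes the end points, so the total charge is \<open>0\<close>.
\<close>

definition charge :: "real \<Rightarrow> (real \<Rightarrow> int) \<Rightarrow> bool" where
  "charge L q \<longleftrightarrow> finite {u. q u \<noteq> 0} \<and> {u. q u \<noteq> 0} \<subseteq> {0..L} \<and> (\<Sum>u | q u \<noteq> 0. q u) = 0"

lemma ramp_superset:
  assumes "finite Y" "{u. q u \<noteq> 0} \<subseteq> Y"
  shows "ramp q t = (\<Sum>u\<in>Y. of_int (q u) * max 0 (t - u))"
  unfolding ramp_def using assms by (intro sum.mono_neutral_left) auto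

lemma ramp_0: "{u. q u \<noteq> 0} \<subseteq> {0..L} \<Longrightarrow> ramp q 0 = 0"
  unfolding ramp_def by (intro sum.neutral) auto

text \<open>Total charge zero cancels the terms with \<open>L\<close>. Thus the function closes up
  to a function on a circle exactly when the first moment of the charge vanishes, which links slopes
  to the torus coordinates.\<close>

lemma ramp_end:
  assumes "charge L q"
  shows "ramp q L = - (\<Sum>u | q u \<noteq> 0. of_int (q u) * u)"
proof -
  have "ramp q L = (\<Sum>u | q u \<noteq> 0. of_int (q u) * L - of_int (q u) * u)"
    unfolding ramp_def using assms by (intro sum.cong) (auto simp: charge_def algebra_simps)
  also have "\<dots> = of_int (\<Sum>u | q u \<noteq> 0. q u) * L - (\<Sum>u | q u \<noteq> 0. of_int (q u) * u)"
    by (simp add: sum_subtractf sum_distrib_right)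
  finally show ?thesis using assms by (simp add: charge_def del: of_int_sum)
qed

lemma eventually_ramp_right:
  assumes "finite {u. q u \<noteq> 0}"
  shows "\<forall>\<^sub>F h in at_right 0. ramp q (t + h) = ramp q t + of_int (\<Sum>u | q u \<noteq> 0. q u * of_bool (u \<le> t)) * h"
proof -
  have "\<forall>\<^sub>F h in at_right 0. max 0 (t + h - u) = max 0 (t - u) + of_bool (u \<le> t) * h" for u :: real
  proof (cases "u \<le> t")
    case True
    have "\<forall>\<^sub>F h in at_right (0::real). h \<in> {0<..<1}" by (rule eventually_at_right_real) simp
    then show ?thesis by eventually_elim (use True in auto)
  next
    case False
    have "\<forall>\<^sub>F h in at_right (0::real). h \<in> {0<..<u - t}"
      using False by (intro eventually_at_right_real) simp
    then show ?thesis by eventually_elim (use False in auto)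
  qed
  then have "\<forall>\<^sub>F h in at_right 0. \<forall>u\<in>{u. q u \<noteq> 0}. max 0 (t + h - u) = max 0 (t - u) + of_bool (u \<le> t) * h"
    using assms by (intro eventually_ball_finite) auto
  then show ?thesis
  proof eventually_elim
    case (elim h)
    have "ramp q (t + h) = (\<Sum>u | q u \<noteq> 0. of_int (q u) * (max 0 (t - u) + of_bool (u \<le> t) * h))"
      unfolding ramp_def using elim by (intro sum.cong) auto
    then show ?case
      by (simp add: ramp_def algebra_simps sum.distrib sum_distrib_left del: sum_of_bool_mult_eq sum_mult_of_bool_eq)
  qed
qed

lemma eventually_ramp_left:
  assumes "finite {u. q u \<noteq> 0}"
  shows "\<forall>\<^sub>F h in at_right 0. ramp q (t - h) = ramp q t + of_int (- (\<Sum>u | q u \<noteq> 0. q u * of_bool (u < t))) * h"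
proof -
  have "\<forall>\<^sub>F h in at_right 0. max 0 (t - h - u) = max 0 (t - u) - of_bool (u < t) * h" for u :: real
  proof (cases "u < t")
    case False
    have "\<forall>\<^sub>F h in at_right (0::real). h \<in> {0<..<1}" by (rule eventually_at_right_real) simp
    then show ?thesis by eventually_elim (use False in auto)
  next
    case True
    have "\<forall>\<^sub>F h in at_right (0::real). h \<in> {0<..<t - u}"
      using True by (intro eventually_at_right_real) simp
    then show ?thesis by eventually_elim (use True in auto)
  qed
  then have "\<forall>\<^sub>F h in at_right 0. \<forall>u\<in>{u. q u \<noteq> 0}. max 0 (t - h - u) = max 0 (t - u) - of_bool (u < t) * h"
    using assms by (intro eventually_ball_finite) auto
  then show ?thesis
  proof eventually_elim
    case (elim h)
    have "ramp q (t - h) = (\<Sum>u | q u \<noteq> 0. of_int (q u) * (max 0 (t - u) - of_bool (u < t) * h))"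
      unfolding ramp_def using elim by (intro sum.cong) auto
    then show ?case
      by (simp add: ramp_def algebra_simps sum_subtractf sum_distrib_left del: sum_of_bool_mult_eq sum_mult_of_bool_eq)
  qed
qed

lemma sorted_hd_le: "sorted xs \<Longrightarrow> x \<in> set xs \<Longrightarrow> hd xs \<le> (x :: 'a :: linorder)"
  by (cases xs) auto

lemma sorted_le_last: "sorted xs \<Longrightarrow> x \<in> set xs \<Longrightarrow> x \<le> (last xs :: 'a :: linorder)"
  by (induction xs) auto

lemma piecewise_integer_linear_imp_ramp:
  assumes "piecewise_integer_linear L \<phi>"
  obtains q where "charge L q" "\<And>t. t \<in> {0..L} \<Longrightarrow> \<phi> t = \<phi> 0 + ramp q t"
proof -
  have ramp: "\<exists>q. finite {u. q u \<noteq> 0} \<and> {u. q u \<noteq> 0} \<subseteq> {0..last xs} \<and>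
          (\<forall>t\<in>{0..last xs}. \<phi> t = \<phi> 0 + ramp q t)"
    if "xs \<noteq> []" "sorted xs" "hd xs = 0"
      "\<forall>i. Suc i < length xs \<longrightarrow>
           (\<exists>m::int. \<forall>t\<in>{xs ! i..xs ! Suc i}. \<phi> t = \<phi> (xs ! i) + of_int m * (t - xs ! i))" for xs
    using that
  proof (induction xs rule: rev_induct)
    case (snoc y xs)
    show ?case
    proof (cases "xs = []")
      case True
      then show ?thesis using snoc.prems(3) by (intro exI[of _ "\<lambda>_. 0"]) (auto simp: ramp_def)
    next
      case False
      define z where "z = last xs"
      have z: "xs ! (length xs - 1) = z" using False by (simp add: z_def last_conv_nth)
      have slopes: "\<exists>m::int. \<forall>t\<in>{xs ! i..xs ! Suc i}. \<phi> t = \<phi> (xs ! i) + of_int m * (t - xs ! i)"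
        if "Suc i < length xs" for i
      proof -
        have "(xs @ [y]) ! i = xs ! i" "(xs @ [y]) ! Suc i = xs ! Suc i"
          using that by (simp_all add: nth_append)
        then show ?thesis using snoc.prems(4)[rule_format, of i] that by simp
      qed
      have "sorted xs" "hd xs = 0" "z \<le> y" using snoc.prems(1-3) False by (auto simp: sorted_append z_def)
      then have "0 \<le> z" using False by (cases xs) (auto simp: z_def)
      have "\<exists>q. finite {u. q u \<noteq> 0} \<and> {u. q u \<noteq> 0} \<subseteq> {0..z} \<and> (\<forall>t\<in>{0..z}. \<phi> t = \<phi> 0 + ramp q t)"
        unfolding z_def using \<open>sorted xs\<close> \<open>hd xs = 0\<close>
        by (intro snoc.IH[OF False]) (assumption | intro allI impI slopes)+
      then obtain q where q: "finite {u. q u \<noteq> 0}" "{u. q u \<noteq> 0} \<subseteq> {0..z}"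
        "\<And>t. t \<in> {0..z} \<Longrightarrow> \<phi> t = \<phi> 0 + ramp q t"
        by blast
      have "(xs @ [y]) ! (length xs - 1) = z" "(xs @ [y]) ! Suc (length xs - 1) = y"
        "Suc (length xs - 1) < length (xs @ [y])"
        using False z by (simp_all add: nth_append)
      then obtain m :: int where m: "\<And>t. t \<in> {z..y} \<Longrightarrow> \<phi> t = \<phi> z + of_int m * (t - z)"
        using snoc.prems(4)[rule_format, of "length xs - 1"] by metis
      \<comment> \<open>\<open>M\<close> is the slope of \<open>ramp q\<close> to the right of all
        its charges and \<open>m\<close> the slope of the new piece; the jump becomes an additional
        charge at \<open>z\<close>.\<close>
      define M where "M = (\<Sum>u | q u \<noteq> 0. q u)"
      define q' where "q' = q(z := q z + m - M)"
      let ?Y = "insert z {u. q u \<noteq> 0}"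
      have supp: "{u. q' u \<noteq> 0} \<subseteq> ?Y" by (auto simp: q'_def)
      have ramp_q': "ramp q' t = ramp q t + of_int (m - M) * max 0 (t - z)" for t
      proof -
        have "ramp q' t = (\<Sum>u\<in>?Y. of_int (q u) * max 0 (t - u) + (if u = z then of_int (m - M) * max 0 (t - z) else 0))"
          unfolding ramp_superset[OF _ supp, simplified, OF q(1)]
          by (intro sum.cong) (auto simp: q'_def algebra_simps)
        also have "\<dots> = ramp q t + of_int (m - M) * max 0 (t - z)"
          using q(1) by (subst sum.distrib) (simp add: ramp_superset[of ?Y q] subset_insertI del: sum.insert_if)
        finally show ?thesis .
      qed
      have "\<phi> t = \<phi> 0 + ramp q' t" if t: "t \<in> {0..y}" for t
      proof (cases "t \<le> z")
        case True
        then show ?thesis using q(3)[of t] t by (simp add: ramp_q')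
      next
        case False
        have "ramp q t = (\<Sum>u | q u \<noteq> 0. of_int (q u) * max 0 (z - u) + of_int (q u) * (t - z))"
          unfolding ramp_def using False q(2) by (intro sum.cong) (auto simp: algebra_simps)
        also have "\<dots> = ramp q z + of_int M * (t - z)"
          by (simp add: sum.distrib ramp_def M_def sum_distrib_right)
        finally show ?thesis using m[of t] q(3)[of z] \<open>0 \<le> z\<close> t False
          by (simp add: ramp_q' algebra_simps)
      qed
      moreover have "finite {u. q' u \<noteq> 0}" using supp q(1) finite_subset by blast
      moreover have "{u. q' u \<noteq> 0} \<subseteq> {0..y}"
        using supp q(2) \<open>0 \<le> z\<close> \<open>z \<le> y\<close> by fastforce
      ultimately show ?thesis unfolding last_snoc by blast
    qed
  qed simp
  obtain xs where xs: "xs \<noteq> []" "sorted xs" "hd xs = 0" "last xs = L"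
      "\<forall>i. Suc i < length xs \<longrightarrow>
           (\<exists>m::int. \<forall>t\<in>{xs ! i..xs ! Suc i}. \<phi> t = \<phi> (xs ! i) + of_int m * (t - xs ! i))"
    using assms unfolding piecewise_integer_linear_def by blast
  then obtain q where q: "finite {u. q u \<noteq> 0}" "{u. q u \<noteq> 0} \<subseteq> {0..L}"
    "\<And>t. t \<in> {0..L} \<Longrightarrow> \<phi> t = \<phi> 0 + ramp q t"
    using ramp[of xs] by blast
  have "0 \<le> L" using sorted_hd_le[OF xs(2) last_in_set[OF xs(1)]] xs(3,4) by simp
  \<comment> \<open>A charge at \<open>L\<close> does not affect values on \<open>{0..L}\<close>, so
    it can be adjusted to make the total charge zero.\<close>
  define q' where "q' = q(L := q L - (\<Sum>u | q u \<noteq> 0. q u))"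
  let ?Y = "insert L {u. q u \<noteq> 0}"
  have supp: "{u. q' u \<noteq> 0} \<subseteq> ?Y" by (auto simp: q'_def)
  have "(\<Sum>u | q' u \<noteq> 0. q' u) = (\<Sum>u\<in>?Y. q' u)"
    using supp q(1) by (intro sum.mono_neutral_left) auto
  also have "\<dots> = (\<Sum>u\<in>?Y. q u + (if u = L then - (\<Sum>u | q u \<noteq> 0. q u) else 0))"
    by (intro sum.cong) (auto simp: q'_def)
  also have "\<dots> = (\<Sum>u\<in>?Y. q u) - (\<Sum>u | q u \<noteq> 0. q u)"
    using q(1) by (subst sum.distrib) (simp del: sum.insert_if)
  also have "(\<Sum>u\<in>?Y. q u) = (\<Sum>u | q u \<noteq> 0. q u)"
    using q(1) by (intro sum.mono_neutral_right) auto
  finally have "charge L q'"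
    using supp q(1,2) \<open>0 \<le> L\<close> by (auto simp: charge_def dest: finite_subset)
  moreover have "ramp q' t = ramp q t" if "t \<in> {0..L}" for t
  proof -
    have "ramp q' t = (\<Sum>u\<in>?Y. of_int (q' u) * max 0 (t - u))"
      using q(1) supp by (intro ramp_superset) auto
    also have "\<dots> = (\<Sum>u\<in>?Y. of_int (q u) * max 0 (t - u))"
      using that by (intro sum.cong) (auto simp: q'_def)
    also have "\<dots> = ramp q t" using q(1) by (intro ramp_superset[symmetric]) auto
    finally show ?thesis .
  qed
  then have "\<phi> t = \<phi> 0 + ramp q' t" if "t \<in> {0..L}" for t using that q(3)[of t] by (simp only:)
  ultimately show thesis by (rule that)
qed

lemma piecewise_integer_linear_ramp:
  assumes "finite {u. q u \<noteq> 0}" "0 \<le> L" and \<phi>: "\<And>t. t \<in> {0..L} \<Longrightarrow> \<phi> t = K + ramp q t"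
  shows "piecewise_integer_linear L \<phi>"
proof -
  define X where "X = insert 0 (insert L ({u. q u \<noteq> 0} \<inter> {0..L}))"
  define xs where "xs = sorted_list_of_set X"
  have X: "finite X" "X \<noteq> {}" using assms by (auto simp: X_def)
  have xs: "set xs = X" "sorted_wrt (<) xs" "xs \<noteq> []" using X by (auto simp: xs_def)
  have "sorted xs" using xs(2) by (rule strict_sorted_imp_sorted)
  have X_bounds: "0 \<in> X" "L \<in> X" "X \<subseteq> {0..L}" using assms(2) by (auto simp: X_def)
  have "hd xs \<in> {0..L}" "last xs \<in> {0..L}"
    using hd_in_set[OF xs(3)] last_in_set[OF xs(3)] xs(1) X_bounds(3) by blast+
  moreover have "hd xs \<le> 0" "L \<le> last xs"
    using sorted_hd_le sorted_le_last \<open>sorted xs\<close> X_bounds xs(1) by blast+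
  ultimately have "hd xs = 0" "last xs = L" by auto
  moreover have "\<exists>m::int. \<forall>t\<in>{xs ! i..xs ! Suc i}. \<phi> t = \<phi> (xs ! i) + of_int m * (t - xs ! i)"
    if i: "Suc i < length xs" for i
  proof (intro exI ballI)
    let ?a = "xs ! i" and ?b = "xs ! Suc i"
    fix t assume t: "t \<in> {?a..?b}"
    have ab: "?a \<in> X" "?b \<in> X" using i xs(1) by auto
    then have "t \<in> {0..L}" "?a \<in> {0..L}" using t X_bounds(3) by force+
    have max: "max 0 (t - u) = max 0 (?a - u) + of_bool (u \<le> ?a) * (t - ?a)" if "q u \<noteq> 0" for u
    proof -
      \<comment> \<open>Consecutive breakpoints enclose no charge, so between them every single ramp
        is linear.\<close>
      have "\<not> (?a < u \<and> u < ?b)"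
      proof
        assume u: "?a < u \<and> u < ?b"
        then have "u \<in> X" using ab that assms(2) by (auto simp: X_def)
        then obtain j where j: "j < length xs" "xs ! j = u" using xs by (metis in_set_conv_nth)
        have mono: "i' < j' \<Longrightarrow> j' < length xs \<Longrightarrow> xs ! i' < xs ! j'" for i' j'
          using xs(2) by (simp add: sorted_wrt_iff_nth_less)
        have "j \<noteq> i" "j \<noteq> Suc i" using u j by auto
        then consider "j < i" | "Suc i < j" by linarith
        then show False
        proof cases
          case 1
          then show False using mono[of j i] i u j by auto
        next
          case 2
          then show False using mono[of "Suc i" j] u j by auto
        qed
      qed
      then show ?thesis using t by auto
    qed
    have "ramp q t = (\<Sum>u | q u \<noteq> 0. of_int (q u) * (max 0 (?a - u) + of_bool (u \<le> ?a) * (t - ?a)))"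
      unfolding ramp_def using max by (intro sum.cong) auto
    also have "\<dots> = ramp q ?a + of_int (\<Sum>u | q u \<noteq> 0. q u * of_bool (u \<le> ?a)) * (t - ?a)"
      by (simp add: ramp_def distrib_left sum.distrib sum_distrib_right mult.assoc
          del: sum_of_bool_mult_eq sum_mult_of_bool_eq)
    finally show "\<phi> t = \<phi> ?a + of_int (\<Sum>u | q u \<noteq> 0. q u * of_bool (u \<le> ?a)) * (t - ?a)"
      using \<phi>[OF \<open>t \<in> {0..L}\<close>] \<phi>[OF \<open>?a \<in> {0..L}\<close>] by simp
  qed
  ultimately show ?thesis unfolding piecewise_integer_linear_def
    using xs(3) \<open>sorted xs\<close> by blast
qed

section \<open>Recovering charges from outgoing slopes\<close>

definition net_slope :: "'e metric_graph \<Rightarrow> ('e point \<Rightarrow> real) \<Rightarrow> 'e \<times> real \<Rightarrow> int" where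
  "net_slope G f = (\<lambda>(e, t). \<Sum>s | s = 1 \<and> t < len G e \<or> s = -1 \<and> 0 < t. outgoing_slope G f (e, t, s))"

lemma outgoing_slopeI:
  assumes "\<forall>\<^sub>F h in at_right 0. f (point_of G e (t + s * h)) = f (point_of G e t) + of_int m * h"
  shows "outgoing_slope G f (e, t, s) = m"
  unfolding outgoing_slope_def prod.case
proof (rule the_equality)
  fix m' :: int
  assume "\<forall>\<^sub>F h in at_right 0. f (point_of G e (t + s * h)) = f (point_of G e t) + of_int m' * h"
  with assms have "\<forall>\<^sub>F h in at_right (0::real). of_int m * h = of_int m' * h"
    by eventually_elim auto
  moreover have "\<forall>\<^sub>F h in at_right (0::real). 0 < h" by (rule eventually_at_right_less)
  ultimately have "\<forall>\<^sub>F h in at_right (0::real). m = m'" by eventually_elim auto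
  then show "m' = m" by simp
qed (rule assms)

text \<open>The outgoing slopes are the charge up to and including \<open>t\<close>, and minus the
  charge strictly before \<open>t\<close>; they add up to \<open>q t\<close>. At an end of the
  segment the missing direction would contribute \<open>0\<close>: at the right end because the
  total charge is zero, at the left end because there is no charge before it.\<close>

lemma net_slope_eq_charge:
  assumes "charge (len G e) q" "\<And>t. t \<in> {0..len G e} \<Longrightarrow> f (point_of G e t) = K + ramp q t"
    and t: "t \<in> {0..len G e}"
  shows "net_slope G f (e, t) = q t"
proof -
  let ?L = "len G e"
  let ?R = "\<Sum>u | q u \<noteq> 0. q u * of_bool (u \<le> t)" and ?S = "\<Sum>u | q u \<noteq> 0. q u * of_bool (u < t)"
  have fin: "finite {u. q u \<noteq> 0}" and supp: "\<And>u. q u \<noteq> 0 \<Longrightarrow> u \<in> {0..?L}"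
    and tot: "(\<Sum>u | q u \<noteq> 0. q u) = 0"
    using assms(1) by (auto simp: charge_def)
  have right: "outgoing_slope G f (e, t, 1) = ?R" if "t < ?L"
  proof (rule outgoing_slopeI)
    have "\<forall>\<^sub>F h in at_right (0::real). h \<in> {0<..<?L - t}"
      using that by (intro eventually_at_right_real) simp
    with eventually_ramp_right[OF fin, of t]
    show "\<forall>\<^sub>F h in at_right 0. f (point_of G e (t + 1 * h)) = f (point_of G e t) + of_int ?R * h"
      by eventually_elim (use t in \<open>auto simp: assms(2) simp del: sum_mult_of_bool_eq\<close>)
  qed
  have left: "outgoing_slope G f (e, t, -1) = - ?S" if "0 < t"
  proof (rule outgoing_slopeI)
    have "\<forall>\<^sub>F h in at_right (0::real). h \<in> {0<..<t}"
      using that by (intro eventually_at_right_real) simp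
    with eventually_ramp_left[OF fin, of t]
    show "\<forall>\<^sub>F h in at_right 0. f (point_of G e (t + -1 * h)) = f (point_of G e t) + of_int (- ?S) * h"
      by eventually_elim (use t in \<open>auto simp: assms(2) simp del: sum_mult_of_bool_eq\<close>)
  qed
  have "?R = 0" if "t = ?L"
  proof -
    have "?R = (\<Sum>u | q u \<noteq> 0. q u)" using supp that by (intro sum.cong) auto
    then show ?thesis using tot by simp
  qed
  moreover have "?S = 0" if "t = 0"
    using supp that by (intro sum.neutral) fastforce
  moreover have "?R - ?S = q t"
  proof -
    have "?R - ?S = (\<Sum>u | q u \<noteq> 0. if u = t then q u else 0)"
      unfolding sum_subtractf[symmetric] by (intro sum.cong) auto
    then show ?thesis using fin by simp
  qed
  moreover have "net_slope G f (e, t) = (if t < ?L then ?R else 0) - (if 0 < t then ?S else 0)"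
  proof -
    have "{s :: real. s = 1 \<and> t < ?L \<or> s = -1 \<and> 0 < t} =
        (if t < ?L then {1} else {}) \<union> (if 0 < t then {-1} else {})" by auto
    then show ?thesis using left right by (auto simp: net_slope_def)
  qed
  ultimately show ?thesis using t by auto
qed

section \<open>Sums over the points of a metric graph\<close>

locale finite_metric_graph =
  fixes G :: "'e metric_graph"
  assumes finite_segs: "finite (segs G)"
    and finite_glue: "finite (glue G)"
    and glue_subset: "glue G \<subseteq> raw_points G \<times> raw_points G"
begin

definition class_of :: "'e \<times> real \<Rightarrow> 'e point" where
  "class_of x = point_of G (fst x) (snd x)"

definition rep :: "'e point \<Rightarrow> 'e \<times> real" where
  "rep p = (SOME x. x \<in> p)"

definition push :: "('e \<times> real \<Rightarrow> int) \<Rightarrow> 'e point \<Rightarrow> int" where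
  "push q p = (if p \<in> points G then \<Sum>x\<in>p. q x else 0)"

text \<open>A right inverse of \<open>push\<close> on divisors: the multiplicity of a point is
  placed on its chosen representative.\<close>

definition lift :: "('e point \<Rightarrow> int) \<Rightarrow> 'e \<times> real \<Rightarrow> int" where
  "lift D x = (if x \<in> raw_points G \<and> rep (class_of x) = x then D (class_of x) else 0)"

text \<open>The pairing of a divisor with a function on raw points. The constant \<open>1\<close>
  gives the degree, and the retraction onto a loop gives a torus coordinate.\<close>

definition weighted_sum :: "('e \<times> real \<Rightarrow> real) \<Rightarrow> ('e point \<Rightarrow> int) \<Rightarrow> real" where
  "weighted_sum \<omega> D = (\<Sum>p | D p \<noteq> 0. of_int (D p) * \<omega> (rep p))"

lemma point_of_eq: "point_of G e t = class_of (e, t)"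
  by (simp add: class_of_def)

lemma class_of_eq: "class_of x = glue_rel G `` {x}"
  by (simp add: class_of_def point_of_def)

lemma equiv_glue_rel: "equiv (raw_points G) (glue_rel G)"
proof (rule equivI)
  have "sym ((glue G \<union> (glue G)\<inverse>)\<^sup>*)" by (intro sym_rtrancl sym_Un_converse)
  then show "sym (glue_rel G)" unfolding glue_rel_def by (intro sym_Int) (auto intro: symI)
  show "trans (glue_rel G)" unfolding glue_rel_def
    by (intro trans_Int trans_rtrancl) (auto intro: transI)
qed (auto simp: glue_rel_def refl_on_def)

lemma class_of_mem_points: "x \<in> raw_points G \<Longrightarrow> class_of x \<in> points G"
  unfolding class_of_eq points_def by (rule quotientI)

lemma mem_class_of: "x \<in> raw_points G \<Longrightarrow> x \<in> class_of x"
  unfolding class_of_eq using equiv_class_self[OF equiv_glue_rel] .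

lemma points_subset_raw: "p \<in> points G \<Longrightarrow> p \<subseteq> raw_points G"
  unfolding points_def using Union_quotient[OF equiv_glue_rel] by blast

lemma class_of_mem:
  assumes "p \<in> points G" "x \<in> p"
  shows "class_of x = p"
proof -
  obtain y where "y \<in> raw_points G" "p = glue_rel G `` {y}"
    using assms(1) unfolding points_def by (auto elim: quotientE)
  then show ?thesis using assms(2) equiv_class_eq[OF equiv_glue_rel, of y x] by (auto simp: class_of_eq)
qed

lemma mem_point_iff: "p \<in> points G \<Longrightarrow> x \<in> p \<longleftrightarrow> x \<in> raw_points G \<and> class_of x = p"
  using points_subset_raw[of p] class_of_mem[of p x] mem_class_of[of x] by auto

lemma rep_mem: "p \<in> points G \<Longrightarrow> rep p \<in> p"
proof -
  assume "p \<in> points G"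
  then have "p \<noteq> {}" unfolding points_def by (rule in_quotient_imp_non_empty[OF equiv_glue_rel])
  then show ?thesis unfolding rep_def by (rule some_in_eq[THEN iffD2])
qed

lemma class_of_rep: "p \<in> points G \<Longrightarrow> class_of (rep p) = p"
  using rep_mem class_of_mem by blast

lemma class_of_glue: "(x, y) \<in> glue G \<Longrightarrow> class_of x = class_of y"
  unfolding class_of_eq
proof (rule equiv_class_eq[OF equiv_glue_rel])
  assume "(x, y) \<in> glue G"
  then show "(x, y) \<in> glue_rel G" using glue_subset by (auto simp: glue_rel_def)
qed

lemma glue_mem_iff: "(x, y) \<in> glue G \<Longrightarrow> p \<in> points G \<Longrightarrow> x \<in> p \<longleftrightarrow> y \<in> p"
  using glue_subset class_of_glue[of x y] by (auto simp: mem_point_iff)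

text \<open>Apart from the chosen representative, all members of a class take part in one of the
  finitely many identifications. Finiteness matters since a sum over an infinite class would default
  to \<open>0\<close>.\<close>

lemma finite_point:
  assumes "p \<in> points G"
  shows "finite p"
proof -
  let ?R = "glue G \<union> (glue G)\<inverse>"
  have "p \<subseteq> insert (rep p) (Range ?R)"
  proof
    fix y assume "y \<in> p"
    then have "(rep p, y) \<in> glue_rel G"
      using class_of_rep[OF assms] by (auto simp: class_of_eq)
    then have "(rep p, y) \<in> ?R\<^sup>*" by (simp add: glue_rel_def)
    then show "y \<in> insert (rep p) (Range ?R)" by (cases rule: rtranclE) auto
  qed
  moreover have "finite (insert (rep p) (Range ?R))" using finite_glue by (simp add: finite_Range)
  ultimately show ?thesis by (rule finite_subset)
qed

text \<open>Reduces compatibility with the generated relation to the generating identifications. It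
  is applied to congruence of retractions and to equality of function values.\<close>

lemma glue_rel_respects:
  assumes "(x, y) \<in> glue_rel G" "\<And>x y. (x, y) \<in> glue G \<Longrightarrow> R x y"
    "reflp R" "symp R" "transp R"
  shows "R x y"
proof -
  have "(x, y) \<in> (glue G \<union> (glue G)\<inverse>)\<^sup>*" using assms(1) by (simp add: glue_rel_def)
  then show ?thesis
  proof (induction rule: rtrancl_induct)
    case base
    then show ?case using assms(3) by (rule reflpD)
  next
    case (step y z)
    then have "(y, z) \<in> glue G \<or> (z, y) \<in> glue G" by auto
    then have "R y z" using assms(2) sympD[OF assms(4)] by blast
    then show ?case using step.IH transpD[OF assms(5)] by blast
  qed
qed

lemma glue_rel_rep: "x \<in> raw_points G \<Longrightarrow> (x, rep (class_of x)) \<in> glue_rel G"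
  using rep_mem[OF class_of_mem_points] by (auto simp: class_of_eq)

lemma principal_divisor_eq_push: "principal_divisor G f = push (net_slope G f)"
proof
  fix p
  show "principal_divisor G f p = push (net_slope G f) p"
  proof (cases "p \<in> points G")
    case True
    define S where "S x = {s :: real. s = 1 \<and> snd x < len G (fst x) \<or> s = -1 \<and> 0 < snd x}" for x :: "'e \<times> real"
    have fin: "finite (S x)" for x
      by (rule finite_subset[of _ "{1, -1}"]) (auto simp: S_def)
    have "push (net_slope G f) p = (\<Sum>x\<in>p. \<Sum>s\<in>S x. outgoing_slope G f (fst x, snd x, s))"
      using True by (simp add: push_def net_slope_def S_def split_beta)
    also have "\<dots> = (\<Sum>(x, s)\<in>Sigma p S. outgoing_slope G f (fst x, snd x, s))"
      using fin finite_point[OF True] by (intro sum.Sigma) auto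
    also have "\<dots> = (\<Sum>d\<in>tangent_directions G p. outgoing_slope G f d)"
      by (rule sum.reindex_bij_witness[where i = "\<lambda>(e, t, s). ((e, t), s)" and j = "\<lambda>((e, t), s). (e, t, s)"])
        (auto simp: tangent_directions_def S_def)
    finally show ?thesis using True by (simp add: principal_divisor_def)
  qed (simp add: principal_divisor_def push_def)
qed

lemma finite_push:
  assumes "finite {x. q x \<noteq> 0}"
  shows "finite {p. push q p \<noteq> 0}"
proof (rule finite_subset)
  show "{p. push q p \<noteq> 0} \<subseteq> class_of ` {x. q x \<noteq> 0}"
  proof
    fix p assume "p \<in> {p. push q p \<noteq> 0}"
    then have p: "p \<in> points G" "(\<Sum>x\<in>p. q x) \<noteq> 0" by (auto simp: push_def split: if_splits)
    then obtain x where "x \<in> p" "q x \<noteq> 0" by (meson sum.neutral)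
    then show "p \<in> class_of ` {x. q x \<noteq> 0}" using class_of_mem[OF p(1)] by blast
  qed
qed (use assms in simp)

lemma weighted_sum_push:
  assumes "finite {x. q x \<noteq> 0}" "{x. q x \<noteq> 0} \<subseteq> raw_points G"
  shows "weighted_sum \<omega> (push q) = (\<Sum>x | q x \<noteq> 0. of_int (q x) * \<omega> (rep (class_of x)))"
proof -
  let ?X = "{x. q x \<noteq> 0}" and ?P = "class_of ` {x. q x \<noteq> 0}"
  have P: "?P \<subseteq> points G" using assms(2) class_of_mem_points by blast
  have push: "push q p = (\<Sum>x | x \<in> ?X \<and> class_of x = p. q x)" if "p \<in> points G" for p
    unfolding push_def using that finite_point[OF that] assms(2)
    by (auto simp: mem_point_iff intro!: sum.mono_neutral_right)
  have "weighted_sum \<omega> (push q) = (\<Sum>p\<in>?P. of_int (push q p) * \<omega> (rep p))"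
    unfolding weighted_sum_def
  proof (rule sum.mono_neutral_left)
    show "{p. push q p \<noteq> 0} \<subseteq> ?P"
    proof
      fix p assume p: "p \<in> {p. push q p \<noteq> 0}"
      then have "p \<in> points G" by (auto simp: push_def split: if_splits)
      then have "(\<Sum>x | x \<in> ?X \<and> class_of x = p. q x) \<noteq> 0" using p push by auto
      then have "{x. x \<in> ?X \<and> class_of x = p} \<noteq> {}" by (metis sum.empty)
      then show "p \<in> ?P" by blast
    qed
  qed (use assms in auto)
  also have "\<dots> = (\<Sum>p\<in>?P. \<Sum>x | x \<in> ?X \<and> class_of x = p. of_int (q x) * \<omega> (rep (class_of x)))"
  proof (rule sum.cong[OF refl])
    fix p assume "p \<in> ?P"
    then have "p \<in> points G" using P by blast
    then show "of_int (push q p) * \<omega> (rep p) =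
        (\<Sum>x | x \<in> ?X \<and> class_of x = p. of_int (q x) * \<omega> (rep (class_of x)))"
      by (simp add: push sum_distrib_right)
  qed
  also have "\<dots> = (\<Sum>x\<in>?X. of_int (q x) * \<omega> (rep (class_of x)))"
    using assms(1) by (intro sum.group) auto
  finally show ?thesis .
qed

lemma lift_support:
  assumes "divisor G D"
  shows "finite {x. lift D x \<noteq> 0}" "{x. lift D x \<noteq> 0} \<subseteq> raw_points G"
proof -
  have "{x. lift D x \<noteq> 0} \<subseteq> rep ` {p. D p \<noteq> 0}"
  proof
    fix x assume "x \<in> {x. lift D x \<noteq> 0}"
    then have "D (class_of x) \<noteq> 0" "rep (class_of x) = x" by (auto simp: lift_def split: if_splits)
    then show "x \<in> rep ` {p. D p \<noteq> 0}" by (intro image_eqI[of x rep "class_of x"]) auto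
  qed
  then show "finite {x. lift D x \<noteq> 0}" using assms by (auto simp: divisor_def dest: finite_subset)
  show "{x. lift D x \<noteq> 0} \<subseteq> raw_points G" by (auto simp: lift_def split: if_splits)
qed

lemma push_lift:
  assumes "divisor G D"
  shows "push (lift D) = D"
proof
  fix p
  show "push (lift D) p = D p"
  proof (cases "p \<in> points G")
    case True
    have "lift D x = (if x = rep p then D p else 0)" if "x \<in> p" for x
      using that class_of_mem[OF True that] points_subset_raw[OF True] by (auto simp: lift_def)
    then have "(\<Sum>x\<in>p. lift D x) = (\<Sum>x\<in>p. if x = rep p then D p else 0)" by (intro sum.cong) auto
    also have "\<dots> = D p" using rep_mem[OF True] finite_point[OF True] by simp
    finally show ?thesis using True by (simp add: push_def)
  next
    case False
    then show ?thesis using assms by (auto simp: push_def divisor_def)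
  qed
qed

lemma weighted_sum_lift:
  assumes "divisor G D"
  shows "weighted_sum \<omega> D = (\<Sum>x | lift D x \<noteq> 0. of_int (lift D x) * \<omega> x)"
proof -
  have "weighted_sum \<omega> (push (lift D)) = (\<Sum>x | lift D x \<noteq> 0. of_int (lift D x) * \<omega> (rep (class_of x)))"
    by (rule weighted_sum_push[OF lift_support[OF assms]])
  also have "\<dots> = (\<Sum>x | lift D x \<noteq> 0. of_int (lift D x) * \<omega> x)"
    by (intro sum.cong) (auto simp: lift_def split: if_splits)
  finally show ?thesis by (simp add: push_lift[OF assms])
qed

lemma sum_support_segs:
  fixes h :: "'e \<times> real \<Rightarrow> real"
  assumes "finite {x. q x \<noteq> 0}" "{x. q x \<noteq> 0} \<subseteq> raw_points G"
  shows "(\<Sum>x | q x \<noteq> 0. of_int (q x) * h x) = (\<Sum>e\<in>segs G. \<Sum>t | q (e, t) \<noteq> 0. of_int (q (e, t)) * h (e, t))"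
proof -
  have "finite {t. q (e, t) \<noteq> 0}" for e
  proof (rule finite_subset)
    show "{t. q (e, t) \<noteq> 0} \<subseteq> snd ` {x. q x \<noteq> 0}" by force
  qed (use assms in simp)
  then have "(\<Sum>e\<in>segs G. \<Sum>t | q (e, t) \<noteq> 0. of_int (q (e, t)) * h (e, t)) =
      (\<Sum>(e, t)\<in>(SIGMA e:segs G. {t. q (e, t) \<noteq> 0}). of_int (q (e, t)) * h (e, t))"
    using finite_segs by (intro sum.Sigma) auto
  also have "(SIGMA e:segs G. {t. q (e, t) \<noteq> 0}) = {x. q x \<noteq> 0}"
    using assms(2) by (auto simp: raw_points_def)
  finally show ?thesis by (simp add: split_beta)
qed

lemma deg_eq_weighted_sum: "of_int (deg D) = weighted_sum (\<lambda>_. 1) D"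
  by (simp add: deg_def weighted_sum_def)

lemma weighted_sum_superset:
  assumes "finite P" "{p. D p \<noteq> 0} \<subseteq> P"
  shows "weighted_sum \<omega> D = (\<Sum>p\<in>P. of_int (D p) * \<omega> (rep p))"
  unfolding weighted_sum_def using assms by (intro sum.mono_neutral_left) auto

lemma divisor_sum:
  assumes "finite I" "\<And>i. i \<in> I \<Longrightarrow> divisor G (D i)"
  shows "divisor G (\<lambda>p. \<Sum>i\<in>I. c i * D i p)"
    and "weighted_sum \<omega> (\<lambda>p. \<Sum>i\<in>I. c i * D i p) = (\<Sum>i\<in>I. of_int (c i) * weighted_sum \<omega> (D i))"
proof -
  define P where "P = (\<Union>i\<in>I. {p. D i p \<noteq> 0})"
  have P: "finite P" "P \<subseteq> points G" using assms by (auto simp: P_def divisor_def)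
  have supp: "{p. (\<Sum>i\<in>I. c i * D i p) \<noteq> 0} \<subseteq> P"
    by (auto simp: P_def intro!: sum.neutral)
  then show "divisor G (\<lambda>p. \<Sum>i\<in>I. c i * D i p)"
    using P finite_subset unfolding divisor_def by blast
  have "weighted_sum \<omega> (\<lambda>p. \<Sum>i\<in>I. c i * D i p) = (\<Sum>p\<in>P. \<Sum>i\<in>I. of_int (c i) * (of_int (D i p) * \<omega> (rep p)))"
    by (simp add: weighted_sum_superset[OF P(1) supp] sum_distrib_right mult.assoc)
  also have "\<dots> = (\<Sum>i\<in>I. of_int (c i) * (\<Sum>p\<in>P. of_int (D i p) * \<omega> (rep p)))"
    by (subst sum.swap) (simp add: sum_distrib_left)
  also have "\<dots> = (\<Sum>i\<in>I. of_int (c i) * weighted_sum \<omega> (D i))"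
  proof (intro sum.cong refl)
    fix i assume "i \<in> I"
    then have "weighted_sum \<omega> (D i) = (\<Sum>p\<in>P. of_int (D i p) * \<omega> (rep p))"
      using P(1) by (intro weighted_sum_superset) (auto simp: P_def)
    then show "of_int (c i) * (\<Sum>p\<in>P. of_int (D i p) * \<omega> (rep p)) = of_int (c i) * weighted_sum \<omega> (D i)"
      by simp
  qed
  finally show "weighted_sum \<omega> (\<lambda>p. \<Sum>i\<in>I. c i * D i p) = (\<Sum>i\<in>I. of_int (c i) * weighted_sum \<omega> (D i))" .
qed

lemma divisor_diff:
  assumes "divisor G D" "divisor G E"
  shows "divisor G (\<lambda>p. D p - E p)"
    and "weighted_sum \<omega> (\<lambda>p. D p - E p) = weighted_sum \<omega> D - weighted_sum \<omega> E"
proof -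
  \<comment> \<open>The difference is the linear combination indexed by the Booleans with
    coefficients \<open>1\<close> and \<open>-1\<close>.\<close>
  let ?D = "\<lambda>b. if b then D else E" and ?c = "\<lambda>b. if b then 1 else -1"
  have eq: "(\<lambda>p. \<Sum>b\<in>UNIV. ?c b * ?D b p) = (\<lambda>p. D p - E p)" by (simp add: UNIV_bool)
  have D: "divisor G (?D b)" for b using assms by simp
  show "divisor G (\<lambda>p. D p - E p)"
    using divisor_sum(1)[of UNIV ?D ?c] D unfolding eq by simp
  show "weighted_sum \<omega> (\<lambda>p. D p - E p) = weighted_sum \<omega> D - weighted_sum \<omega> E"
    using divisor_sum(2)[of UNIV ?D \<omega> ?c] D unfolding eq by (simp add: UNIV_bool)
qed

lemma deg_diff:
  assumes "divisor G D" "divisor G E"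
  shows "deg (\<lambda>p. D p - E p) = deg D - deg E"
proof -
  have "of_int (deg (\<lambda>p. D p - E p)) = (of_int (deg D - deg E) :: real)"
    by (simp add: deg_eq_weighted_sum divisor_diff(2)[OF assms])
  then show ?thesis by (simp only: of_int_eq_iff)
qed

end

section \<open>The Abel--Jacobi theorem for chains of loops\<close>

lemma rcong_of_int_mult: "[x = y] (rmod m) \<Longrightarrow> [of_int n * x = of_int n * y] (rmod m)"
  unfolding rcong_altdef
proof -
  assume "\<exists>k. y = x + of_int k * m"
  then obtain k where "y = x + of_int k * m" ..
  then have "of_int n * y = of_int n * x + of_int (n * k) * m" by (simp add: algebra_simps)
  then show "\<exists>k. of_int n * y = of_int n * x + of_int k * m" ..
qed

lemma rcong_sum: "(\<And>x. x \<in> A \<Longrightarrow> [f x = h x] (rmod m)) \<Longrightarrow> [(\<Sum>x\<in>A. f x) = (\<Sum>x\<in>A. h x)] (rmod m)"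
  by (induction A rule: infinite_finite_induct) (auto intro: rcong_add)

locale chain_of_loops =
  fixes g :: nat and l v w b :: "nat \<Rightarrow> real" and G :: "chain_segment metric_graph"
  assumes g_pos: "1 \<le> g"
    and l_pos: "\<And>i. i \<in> {1..g} \<Longrightarrow> 0 < l i"
    and v_range: "\<And>i. i \<in> {2..g} \<Longrightarrow> v i \<in> {0..<l i}"
    and w_range: "\<And>i. i \<in> {1..<g} \<Longrightarrow> w i \<in> {0..<l i}"
    and b_nonneg: "\<And>i. i \<in> {1..<g} \<Longrightarrow> 0 \<le> b i"
    and G_eq: "G = \<lparr> segs = Loop ` {1..g} \<union> Bridge ` {1..<g},
              len = (\<lambda>e. case e of Loop i \<Rightarrow> l i | Bridge i \<Rightarrow> b i),
              glue = {((Loop i, 0), (Loop i, l i)) | i. i \<in> {1..g}}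
                   \<union> {((Loop i, w i), (Bridge i, 0)) | i. i \<in> {1..<g}}
                   \<union> {((Bridge i, b i), (Loop (Suc i), v (Suc i))) | i. i \<in> {1..<g}} \<rparr>"
begin

lemma segs_G: "segs G = Loop ` {1..g} \<union> Bridge ` {1..<g}"
  by (simp add: G_eq)

lemma len_G [simp]: "len G (Loop i) = l i" "len G (Bridge i) = b i"
  by (simp_all add: G_eq)

lemma glue_G:
  "glue G = (\<lambda>i. ((Loop i, 0), (Loop i, l i))) ` {1..g} \<union> (\<lambda>i. ((Loop i, w i), (Bridge i, 0))) ` {1..<g}
     \<union> (\<lambda>i. ((Bridge i, b i), (Loop (Suc i), v (Suc i)))) ` {1..<g}"
  unfolding G_eq by auto

lemma raw_Loop: "(Loop i, t) \<in> raw_points G \<longleftrightarrow> i \<in> {1..g} \<and> t \<in> {0..l i}"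
  by (auto simp: raw_points_def segs_G)

lemma raw_Bridge: "(Bridge i, t) \<in> raw_points G \<longleftrightarrow> i \<in> {1..<g} \<and> t \<in> {0..b i}"
  by (auto simp: raw_points_def segs_G)

sublocale finite_metric_graph G
proof
  show "finite (segs G)" by (simp add: segs_G)
  show "finite (glue G)" by (simp add: glue_G)
  have "(Loop i, 0) \<in> raw_points G" "(Loop i, l i) \<in> raw_points G" if "i \<in> {1..g}" for i
    using l_pos[OF that] that by (simp_all add: raw_Loop)
  moreover have "(Loop i, w i) \<in> raw_points G" "(Bridge i, 0) \<in> raw_points G" "(Bridge i, b i) \<in> raw_points G"
    "(Loop (Suc i), v (Suc i)) \<in> raw_points G" if "i \<in> {1..<g}" for i
    using w_range[OF that] v_range[of "Suc i"] b_nonneg[OF that] that by (auto simp: raw_Loop raw_Bridge)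
  ultimately show "glue G \<subseteq> raw_points G \<times> raw_points G" unfolding glue_G by blast
qed

text \<open>
  The retraction of the graph onto its \<open>i\<close>-th loop, in the coordinate of that loop.
\<close>

definition omega :: "nat \<Rightarrow> chain_segment \<times> real \<Rightarrow> real" where
  "omega i x = (case fst x of Loop j \<Rightarrow> if j = i then snd x else if j < i then v i else w i
                            | Bridge j \<Rightarrow> if j < i then v i else w i)"

text \<open>The \<open>i\<close>-th Abel-Jacobi coordinate as a real number. Only its residue modulo
  \<open>l i\<close> is intrinsic: the point where the loop closes up can be represented by
  \<open>0\<close> or by \<open>l i\<close>.\<close>

definition jac :: "(chain_segment point \<Rightarrow> int) \<Rightarrow> nat \<Rightarrow> real" where
  "jac D i = weighted_sum (omega i) D"

text \<open>Closing up the \<open>i\<close>-th loop changes the retraction by \<open>l i\<close>;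
  every other identification preserves it exactly.\<close>

lemma omega_glue: "(x, y) \<in> glue G \<Longrightarrow> [omega i x = omega i y] (rmod l i)"
  by (auto simp: glue_G omega_def rcong_def)

lemma omega_rep:
  assumes "x \<in> raw_points G"
  shows "[omega i (rep (class_of x)) = omega i x] (rmod l i)"
proof -
  have "[omega i x = omega i (rep (class_of x))] (rmod l i)"
    by (rule glue_rel_respects[OF glue_rel_rep[OF assms]])
      (erule omega_glue, auto simp: reflp_def symp_def transp_def rcong_def)
  then show ?thesis by (rule rcong_sym)
qed

text \<open>Every segment has total charge zero, which gives degree zero. It also kills the
  contribution to \<open>jac\<close> of each segment other than \<open>Loop i\<close>, since
  \<open>omega i\<close> is constant there. On \<open>Loop i\<close> the first moment vanishes
  because \<open>f\<close> takes the same value at both ends. Congruence instead of equality enters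
  through the choice of representatives.\<close>

lemma principal_divisor_invariants:
  assumes "rational_function G f"
  shows "divisor G (principal_divisor G f)" "deg (principal_divisor G f) = 0"
    "[jac (principal_divisor G f) i = 0] (rmod l i)"
proof -
  have "\<exists>q. charge (len G e) q \<and> (\<forall>t\<in>{0..len G e}. f (point_of G e t) = f (point_of G e 0) + ramp q t)"
    if "e \<in> segs G" for e
    using assms that piecewise_integer_linear_imp_ramp[of "len G e" "\<lambda>t. f (point_of G e t)"]
    unfolding rational_function_def by metis
  then obtain Q where Q: "\<And>e. e \<in> segs G \<Longrightarrow> charge (len G e) (Q e)"
    "\<And>e t. e \<in> segs G \<Longrightarrow> t \<in> {0..len G e} \<Longrightarrow> f (point_of G e t) = f (point_of G e 0) + ramp (Q e) t"
    by metis
  define q where "q x = (if fst x \<in> segs G then Q (fst x) (snd x) else 0)" for x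
  have "net_slope G f x = q x" if "x \<in> raw_points G" for x
  proof -
    obtain e t where x: "x = (e, t)" by (cases x)
    then have et: "e \<in> segs G" "t \<in> {0..len G e}" using that by (auto simp: raw_points_def)
    show ?thesis unfolding x using net_slope_eq_charge[of G e "Q e" f, OF Q(1) Q(2)] et
      by (simp add: q_def)
  qed
  then have "push (net_slope G f) = push q"
    using points_subset_raw by (auto simp: push_def fun_eq_iff intro!: sum.cong)
  then have div: "principal_divisor G f = push q" by (simp add: principal_divisor_eq_push)
  have "{x. q x \<noteq> 0} = (SIGMA e:segs G. {t. Q e t \<noteq> 0})" by (auto simp: q_def split: if_splits)
  moreover have "finite (SIGMA e:segs G. {t. Q e t \<noteq> 0})"
    using finite_segs Q(1) by (intro finite_SigmaI) (auto simp: charge_def)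
  ultimately have fin: "finite {x. q x \<noteq> 0}" by simp
  have "t \<in> {0..len G e}" if "e \<in> segs G" "Q e t \<noteq> 0" for e t
    using Q(1)[OF that(1)] that(2) unfolding charge_def by blast
  then have raw: "{x. q x \<noteq> 0} \<subseteq> raw_points G"
    by (auto simp: q_def raw_points_def split: if_splits)
  show "divisor G (principal_divisor G f)"
    unfolding div divisor_def using finite_push[OF fin] by (auto simp: push_def split: if_splits)
  have const: "(\<Sum>t | q (e, t) \<noteq> 0. of_int (q (e, t)) * k) = (0::real)" if "e \<in> segs G" for e k
  proof -
    have "(\<Sum>t | q (e, t) \<noteq> 0. of_int (q (e, t)) * k) = of_int (\<Sum>t | Q e t \<noteq> 0. Q e t) * k"
      using that by (simp add: q_def sum_distrib_right)
    then show ?thesis using Q(1)[OF that] by (simp add: charge_def del: of_int_sum)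
  qed
  have "of_int (deg (push q)) = (\<Sum>x | q x \<noteq> 0. of_int (q x) * 1 :: real)"
    unfolding deg_eq_weighted_sum by (rule weighted_sum_push[OF fin raw])
  also have "\<dots> = (\<Sum>e\<in>segs G. \<Sum>t | q (e, t) \<noteq> 0. of_int (q (e, t)) * 1)"
    by (rule sum_support_segs[OF fin raw])
  also have "\<dots> = 0" using const[of _ 1] by simp
  finally show "deg (principal_divisor G f) = 0" by (simp add: div)
  have "(\<Sum>x | q x \<noteq> 0. of_int (q x) * omega i x) = (\<Sum>e\<in>segs G. \<Sum>t | q (e, t) \<noteq> 0. of_int (q (e, t)) * omega i (e, t))"
    by (rule sum_support_segs[OF fin raw])
  also have "\<dots> = 0"
  proof (rule sum.neutral, rule ballI)
    fix e assume e: "e \<in> segs G"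
    show "(\<Sum>t | q (e, t) \<noteq> 0. of_int (q (e, t)) * omega i (e, t)) = 0"
    proof (cases "e = Loop i")
      case True
      then have i: "i \<in> {1..g}" using e by (auto simp: segs_G)
      have "f (point_of G e 0) = f (point_of G e (l i))"
        using class_of_glue[of "(Loop i, 0)" "(Loop i, l i)"] i by (auto simp: True point_of_eq glue_G)
      then have "ramp (Q e) (l i) = 0"
        using Q(2)[OF e, of "l i"] l_pos[OF i] by (simp add: True)
      then have "(\<Sum>t | Q e t \<noteq> 0. of_int (Q e t) * t) = 0"
        using ramp_end[OF Q(1)[OF e]] by (simp add: True)
      then show ?thesis using e by (simp add: q_def omega_def True)
    next
      case False
      then obtain k where "\<And>t. omega i (e, t) = k" by (cases e) (auto simp: omega_def)
      then show ?thesis using const[OF e, of k] by simp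
    qed
  qed
  finally have "(\<Sum>x | q x \<noteq> 0. of_int (q x) * omega i x) = 0" .
  moreover have "[jac (push q) i = (\<Sum>x | q x \<noteq> 0. of_int (q x) * omega i x)] (rmod l i)"
    unfolding jac_def weighted_sum_push[OF fin raw]
    using raw by (intro rcong_sum rcong_of_int_mult omega_rep) auto
  ultimately show "[jac (principal_divisor G f) i = 0] (rmod l i)" by (simp add: div)
qed

lemma sum_chain:
  assumes "finite {x. q x \<noteq> 0}" "{x. q x \<noteq> 0} \<subseteq> raw_points G" "finite Y" "snd ` {x. q x \<noteq> 0} \<subseteq> Y"
  shows "(\<Sum>x | q x \<noteq> 0. of_int (q x) * \<omega> x :: real) = (\<Sum>j\<in>{1..g}. (\<Sum>t\<in>Y. of_int (q (Loop j, t)) * \<omega> (Loop j, t))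
      + (\<Sum>t\<in>Y. of_int (q (Bridge j, t)) * \<omega> (Bridge j, t)))"
proof -
  define h where "h e = (\<Sum>t\<in>Y. of_int (q (e, t)) * \<omega> (e, t))" for e
  \<comment> \<open>There is no bridge after the last loop; its zero contribution lets loops and
    bridges be summed over the same range \<open>{1..g}\<close>.\<close>
  have "q (Bridge g, t) = 0" for t
    using assms(2) raw_Bridge[of g t] by auto
  then have h_g: "h (Bridge g) = 0" by (simp add: h_def)
  have "(\<Sum>x | q x \<noteq> 0. of_int (q x) * \<omega> x) = (\<Sum>e\<in>segs G. \<Sum>t | q (e, t) \<noteq> 0. of_int (q (e, t)) * \<omega> (e, t))"
    by (rule sum_support_segs[OF assms(1,2)])
  also have "\<dots> = (\<Sum>e\<in>segs G. h e)"
    unfolding h_def using assms(3,4) by (intro sum.cong sum.mono_neutral_left refl) force+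
  also have "\<dots> = (\<Sum>e\<in>Loop ` {1..g}. h e) + (\<Sum>e\<in>Bridge ` {1..<g}. h e)"
    unfolding segs_G by (intro sum.union_disjoint) auto
  also have "\<dots> = (\<Sum>j\<in>{1..g}. h (Loop j)) + (\<Sum>j\<in>{1..<g}. h (Bridge j))"
    by (simp add: sum.reindex inj_on_def)
  also have "(\<Sum>j\<in>{1..<g}. h (Bridge j)) = (\<Sum>j\<in>{1..g}. h (Bridge j))"
  proof (rule sum.mono_neutral_left)
    show "\<forall>j\<in>{1..g} - {1..<g}. h (Bridge j) = 0"
    proof
      fix j assume "j \<in> {1..g} - {1..<g}"
      then have "j = g" by auto
      then show "h (Bridge j) = 0" using h_g by simp
    qed
  qed auto
  finally show ?thesis by (simp add: sum.distrib h_def)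
qed

lemma weighted_sum_chain:
  assumes "divisor G A" "finite Y" "snd ` {x. lift A x \<noteq> 0} \<subseteq> Y"
  shows "weighted_sum \<omega> A = (\<Sum>j\<in>{1..g}. (\<Sum>t\<in>Y. of_int (lift A (Loop j, t)) * \<omega> (Loop j, t))
      + (\<Sum>t\<in>Y. of_int (lift A (Bridge j, t)) * \<omega> (Bridge j, t)))"
  unfolding weighted_sum_lift[OF assms(1)] using lift_support[OF assms(1)] assms(2,3) by (rule sum_chain)

text \<open>The divisor is lifted to raw points and then corrected by moving weight between glued
  raw points, which does not change the divisor. The amounts are chosen so that every segment has
  total charge zero and every loop has first moment zero. The ramps of the corrected charges then
  fit together to the required function.\<close>

lemma principal_divisor_exists:
  assumes A: "divisor G A" "deg A = 0" and jac0: "\<And>i. i \<in> {1..g} \<Longrightarrow> [jac A i = 0] (rmod l i)"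
  obtains f where "rational_function G f" "principal_divisor G f = A"
proof -
  define q0 where "q0 = lift A"
  define Y where "Y = insert 0 (snd ` {x. q0 x \<noteq> 0} \<union> l ` {1..g} \<union> v ` {1..g} \<union> w ` {1..g} \<union> b ` {1..g})"
  have fin_Y: "finite Y" and q0_Y: "snd ` {x. lift A x \<noteq> 0} \<subseteq> Y"
    using lift_support(1)[OF A(1)] by (auto simp: Y_def q0_def)
  have mem_Y [simp]: "0 \<in> Y" "\<And>i. i \<in> {1..g} \<Longrightarrow> l i \<in> Y" "\<And>i. i \<in> {1..g} \<Longrightarrow> v i \<in> Y"
    "\<And>i. i \<in> {1..g} \<Longrightarrow> w i \<in> Y" "\<And>i. i \<in> {1..g} \<Longrightarrow> b i \<in> Y"
    by (auto simp: Y_def)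
  have q0_mem_Y: "t \<in> Y" if "q0 (e, t) \<noteq> 0" for e t
    using that by (force simp: Y_def)
  have q0_raw: "x \<in> raw_points G" if "q0 x \<noteq> 0" for x
    using lift_support(2)[OF A(1)] that by (auto simp: q0_def)

  txt \<open>\<open>T i\<close> and \<open>S i\<close> are the degrees of \<open>A\<close> up to the end of the \<open>i\<close>-th loop and bridge.\<close>
  define tot where "tot e = (\<Sum>t\<in>Y. q0 (e, t))" for e
  define S where "S i = (\<Sum>j\<in>{1..i}. tot (Loop j) + tot (Bridge j))" for i
  define T where "T i = S (i - 1) + tot (Loop i)" for i
  have S_0: "S 0 = 0" by (simp add: S_def)
  have S_step: "S i = T i + tot (Bridge i)" if "i \<in> {1..g}" for i
  proof -
    from that obtain i' where "i = Suc i'" by (cases i) auto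
    then show ?thesis by (simp add: S_def T_def)
  qed
  have "weighted_sum (\<lambda>_. 1) A = of_int (S g)"
    unfolding weighted_sum_chain[OF A(1) fin_Y q0_Y] by (simp add: S_def tot_def q0_def)
  then have S_g: "S g = 0" using A(2) deg_eq_weighted_sum[of A] by simp
  have "q0 (Bridge g, t) = 0" for t using q0_raw[of "(Bridge g, t)"] raw_Bridge[of g t] by auto
  then have "T g = 0" using S_g S_step[of g] g_pos by (simp add: tot_def)
  define M where "M i = (\<Sum>t\<in>Y. of_int (q0 (Loop i, t)) * t)" for i
  \<comment> \<open>Since the total degree \<open>S g\<close> is zero, the part of \<open>A\<close>
    beyond the \<open>i\<close>-th loop, including the \<open>i\<close>-th bridge, has degree
    \<open>- T i\<close>; it retracts to \<open>w i\<close>.\<close>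
  have jac_A: "jac A i = M i + of_int (S (i - 1)) * v i - of_int (T i) * w i" if i: "i \<in> {1..g}" for i
  proof -
    define h where "h j = (\<Sum>t\<in>Y. of_int (q0 (Loop j, t)) * omega i (Loop j, t))
      + (\<Sum>t\<in>Y. of_int (q0 (Bridge j, t)) * omega i (Bridge j, t))" for j
    have "h j = of_int (tot (Loop j) + tot (Bridge j)) * v i" if "j < i" for j
      using that by (simp add: h_def omega_def tot_def sum_distrib_right distrib_right)
    then have 1: "(\<Sum>j\<in>{1..<i}. h j) = of_int (\<Sum>j\<in>{1..<i}. tot (Loop j) + tot (Bridge j)) * v i"
      unfolding of_int_sum sum_distrib_right by (intro sum.cong) auto
    have "h j = of_int (tot (Loop j) + tot (Bridge j)) * w i" if "j > i" for j
      using that by (simp add: h_def omega_def tot_def sum_distrib_right distrib_right)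
    then have 2: "(\<Sum>j\<in>{i<..g}. h j) = of_int (\<Sum>j\<in>{i<..g}. tot (Loop j) + tot (Bridge j)) * w i"
      unfolding of_int_sum sum_distrib_right by (intro sum.cong) auto
    have 3: "h i = M i + of_int (tot (Bridge i)) * w i"
      by (simp add: h_def omega_def M_def tot_def sum_distrib_right)
    have split: "{1..g} = {1..<i} \<union> {i} \<union> {i<..g}" "{1..g} = {1..i} \<union> {i<..g}" "{1..i - 1} = {1..<i}"
      using i by auto
    have left: "(\<Sum>j\<in>{1..<i}. tot (Loop j) + tot (Bridge j)) = S (i - 1)"
      unfolding S_def split(3) ..
    have right: "(\<Sum>j\<in>{i<..g}. tot (Loop j) + tot (Bridge j)) = S g - S i"
      unfolding S_def split(2) by (subst sum.union_disjoint) auto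
    have "jac A i = (\<Sum>j\<in>{1..g}. h j)"
      unfolding jac_def weighted_sum_chain[OF A(1) fin_Y q0_Y] by (simp add: h_def q0_def)
    also have "\<dots> = (\<Sum>j\<in>{1..<i}. h j) + h i + (\<Sum>j\<in>{i<..g}. h j)"
      unfolding split(1) by (subst sum.union_disjoint) auto
    also have "\<dots> = M i + of_int (S (i - 1)) * v i - of_int (T i) * w i"
      unfolding 1 2 3 left right S_step[OF i] S_g by (simp add: algebra_simps)
    finally show ?thesis .
  qed
  \<comment> \<open>The integer multiple of \<open>l i\<close> is the first moment that will be
    removed by moving \<open>c i\<close> units from the end \<open>l i\<close> of the loop to its
    end \<open>0\<close>.\<close>
  have "\<exists>c::int. jac A i = of_int c * l i" if "i \<in> {1..g}" for i
    using rcong_sym[OF jac0[OF that]] unfolding rcong_altdef by simp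
  then obtain c :: "nat \<Rightarrow> int" where c: "\<And>i. i \<in> {1..g} \<Longrightarrow> jac A i = of_int (c i) * l i" by metis

  \<comment> \<open>Each summand is a difference of two glued raw points. The amount
    \<open>T i\<close> leaves loop \<open>i\<close> at \<open>w i\<close> for the bridge, and
    \<open>S i\<close> leaves the bridge for the next loop; so loop \<open>i\<close> has total
    \<open>tot (Loop i) - T i + S (i - 1) = 0\<close>, and similarly for bridges.\<close>
  define corr :: "chain_segment \<times> real \<Rightarrow> int" where
    "corr x = (\<Sum>i\<in>{1..g}. c i * (of_bool (x = (Loop i, 0)) - of_bool (x = (Loop i, l i))))
        + (\<Sum>i\<in>{1..<g}. T i * (of_bool (x = (Bridge i, 0)) - of_bool (x = (Loop i, w i))))
        + (\<Sum>i\<in>{1..<g}. S i * (of_bool (x = (Loop (Suc i), v (Suc i))) - of_bool (x = (Bridge i, b i))))" for x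
  define q where "q x = q0 x + corr x" for x
  \<comment> \<open>The first and the last loop need no separate formula: the terms at
    \<open>v 1\<close> and \<open>w g\<close> carry the factors \<open>S 0 = 0\<close> and
    \<open>T g = 0\<close>.\<close>
  have corr_Loop: "corr (Loop i, t) = c i * (of_bool (t = 0) - of_bool (t = l i)) - T i * of_bool (t = w i)
      + S (i - 1) * of_bool (t = v i)" if i: "i \<in> {1..g}" for i t
  proof -
    have "(\<Sum>j\<in>{1..g}. c j * (of_bool ((Loop i, t) = (Loop j, 0)) - of_bool ((Loop i, t) = (Loop j, l j))))
        = (\<Sum>j\<in>{1..g}. if j = i then c i * (of_bool (t = 0) - of_bool (t = l i)) else 0)"
      by (intro sum.cong) auto
    also have "\<dots> = c i * (of_bool (t = 0) - of_bool (t = l i))" using i by simp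
    moreover have "(\<Sum>j\<in>{1..<g}. T j * (of_bool ((Loop i, t) = (Bridge j, 0)) - of_bool ((Loop i, t) = (Loop j, w j))))
        = (\<Sum>j\<in>{1..<g}. if j = i then - T i * of_bool (t = w i) else 0)"
      by (intro sum.cong) auto
    moreover have "\<dots> = - T i * of_bool (t = w i)" using i \<open>T g = 0\<close> by (cases "i = g") auto
    moreover have "(\<Sum>j\<in>{1..<g}. S j * (of_bool ((Loop i, t) = (Loop (Suc j), v (Suc j))) - of_bool ((Loop i, t) = (Bridge j, b j))))
        = (\<Sum>j\<in>{1..<g}. if j = i - 1 then S (i - 1) * of_bool (t = v i) else 0)"
      using i by (intro sum.cong) auto
    moreover have "\<dots> = S (i - 1) * of_bool (t = v i)" using i S_0 by (cases "i = 1") auto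
    ultimately show ?thesis by (simp add: corr_def)
  qed
  have corr_Bridge: "corr (Bridge i, t) = T i * of_bool (t = 0) - S i * of_bool (t = b i)" if i: "i \<in> {1..<g}" for i t
  proof -
    have "(\<Sum>j\<in>{1..g}. c j * (of_bool ((Bridge i, t) = (Loop j, 0)) - of_bool ((Bridge i, t) = (Loop j, l j)))) = 0"
      by (intro sum.neutral) auto
    moreover have "(\<Sum>j\<in>{1..<g}. T j * (of_bool ((Bridge i, t) = (Bridge j, 0)) - of_bool ((Bridge i, t) = (Loop j, w j))))
        = (\<Sum>j\<in>{1..<g}. if j = i then T i * of_bool (t = 0) else 0)"
      by (intro sum.cong) auto
    moreover have "\<dots> = T i * of_bool (t = 0)" using i by auto
    moreover have "(\<Sum>j\<in>{1..<g}. S j * (of_bool ((Bridge i, t) = (Loop (Suc j), v (Suc j))) - of_bool ((Bridge i, t) = (Bridge j, b j))))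
        = (\<Sum>j\<in>{1..<g}. if j = i then - S i * of_bool (t = b i) else 0)"
      by (intro sum.cong) auto
    moreover have "\<dots> = - S i * of_bool (t = b i)" using i by auto
    ultimately show ?thesis by (simp add: corr_def)
  qed
  have push_q: "push q = A"
  proof
    fix p
    show "push q p = A p"
    proof (cases "p \<in> points G")
      case True
      have glue: "(\<Sum>x\<in>p. of_bool (x = y) - of_bool (x = z)) = (0::int)" if "(y, z) \<in> glue G" for y z
      proof -
        have "(\<Sum>x\<in>p. of_bool (x = y)) = (of_bool (y \<in> p) :: int)" for y
          using finite_point[OF True] by (simp add: of_bool_def)
        then show ?thesis using glue_mem_iff[OF that True] by (simp add: sum_subtractf)
      qed
      have family: "(\<Sum>x\<in>p. \<Sum>i\<in>I. m i * (of_bool (x = y i) - of_bool (x = z i))) = (0::int)"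
        if "\<And>i. i \<in> I \<Longrightarrow> (y i, z i) \<in> glue G \<or> (z i, y i) \<in> glue G" for I :: "nat set" and m y z
      proof -
        have "(\<Sum>x\<in>p. of_bool (x = y i) - of_bool (x = z i)) = (0::int)" if "i \<in> I" for i
          using \<open>\<And>i. i \<in> I \<Longrightarrow> _\<close>[OF that] glue[of "y i" "z i"] glue[of "z i" "y i"]
          by (auto simp: sum_subtractf)
        then show ?thesis by (subst sum.swap) (simp flip: sum_distrib_left)
      qed
      have "(\<Sum>x\<in>p. corr x) = 0"
        unfolding corr_def sum.distrib by (subst (1 2 3) family) (auto simp: glue_G)
      moreover have "(\<Sum>x\<in>p. q0 x) = A p"
        using True fun_cong[OF push_lift[OF A(1)], of p] by (simp add: push_def q0_def)
      ultimately show ?thesis using True by (simp add: push_def q_def sum.distrib)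
    next
      case False
      then show ?thesis using A(1) by (auto simp: push_def divisor_def)
    qed
  qed

  have charge_Loop: "charge (l i) (\<lambda>t. q (Loop i, t))" and ramp_Loop: "ramp (\<lambda>t. q (Loop i, t)) (l i) = 0"
    if i: "i \<in> {1..g}" for i
  proof -
    \<comment> \<open>The conditions on \<open>T i\<close> and \<open>S (i - 1)\<close> are recorded
      because \<open>w g\<close> and \<open>v 1\<close> may lie outside the loop; in these cases the
      factor vanishes.\<close>
    have support: "t = 0 \<or> t = l i \<or> t = w i \<and> T i \<noteq> 0 \<or> t = v i \<and> S (i - 1) \<noteq> 0 \<or> q0 (Loop i, t) \<noteq> 0"
      if "q (Loop i, t) \<noteq> 0" for t
    proof (rule ccontr)
      assume "\<not> ?thesis"
      then have "of_bool (t = 0) = (0::int)" "of_bool (t = l i) = (0::int)" "T i * of_bool (t = w i) = 0"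
        "S (i - 1) * of_bool (t = v i) = 0" "q0 (Loop i, t) = 0" by auto
      then have "q (Loop i, t) = 0" unfolding q_def corr_Loop[OF i] by (simp only:) simp
      then show False using that by blast
    qed
    have supp_Y: "{t. q (Loop i, t) \<noteq> 0} \<subseteq> Y"
    proof
      fix t assume "t \<in> {t. q (Loop i, t) \<noteq> 0}"
      then show "t \<in> Y" using support[of t] q0_mem_Y[of "Loop i" t] mem_Y i by blast
    qed
    have fin: "finite {t. q (Loop i, t) \<noteq> 0}" using supp_Y fin_Y by (rule finite_subset)
    have "v i \<in> {0..l i}" if "S (i - 1) \<noteq> 0"
      using that i v_range[of i] S_0 by (cases "i = 1") auto
    moreover have "w i \<in> {0..l i}" if "T i \<noteq> 0"
      using that i w_range[of i] \<open>T g = 0\<close> by (cases "i = g") auto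
    moreover have "t \<in> {0..l i}" if "q0 (Loop i, t) \<noteq> 0" for t
      using q0_raw[OF that] raw_Loop by simp
    moreover have "0 \<in> {0..l i}" "l i \<in> {0..l i}" using l_pos[OF i] by auto
    ultimately have supp: "{t. q (Loop i, t) \<noteq> 0} \<subseteq> {0..l i}"
      using support by blast
    \<comment> \<open>Stated for an arbitrary weight \<open>h\<close>: the constant \<open>1\<close>
      yields the total charge, the identity the first moment.\<close>
    have sum_Y: "(\<Sum>t | q (Loop i, t) \<noteq> 0. of_int (q (Loop i, t)) * h t) = (\<Sum>t\<in>Y. of_int (q0 (Loop i, t)) * h t)
        + of_int (c i) * (h 0 - h (l i)) - of_int (T i) * h (w i) + of_int (S (i - 1)) * h (v i)" for h :: "real \<Rightarrow> real"
    proof -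
      have delta: "(\<Sum>t\<in>Y. of_int k * (of_bool (t = y) * h t)) = of_int k * h y" if "y \<in> Y" for k y
      proof -
        have "(\<Sum>t\<in>Y. of_bool (t = y) * h t) = (\<Sum>t\<in>Y. if t = y then h t else 0)"
          by (intro sum.cong) auto
        then show ?thesis using that fin_Y by (simp flip: sum_distrib_left)
      qed
      have "(\<Sum>t | q (Loop i, t) \<noteq> 0. of_int (q (Loop i, t)) * h t) = (\<Sum>t\<in>Y. of_int (q (Loop i, t)) * h t)"
        using supp_Y fin_Y by (intro sum.mono_neutral_left) auto
      also have "\<dots> = (\<Sum>t\<in>Y. of_int (q0 (Loop i, t)) * h t + of_int (c i) * (of_bool (t = 0) * h t)
          - of_int (c i) * (of_bool (t = l i) * h t)
          - of_int (T i) * (of_bool (t = w i) * h t) + of_int (S (i - 1)) * (of_bool (t = v i) * h t))"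
        by (intro sum.cong refl) (simp add: q_def corr_Loop[OF i] algebra_simps)
      also have "\<dots> = (\<Sum>t\<in>Y. of_int (q0 (Loop i, t)) * h t) + of_int (c i) * h 0
          - of_int (c i) * h (l i) - of_int (T i) * h (w i) + of_int (S (i - 1)) * h (v i)"
        using mem_Y i by (simp only: sum.distrib sum_subtractf delta)
      finally show ?thesis by (simp add: right_diff_distrib)
    qed
    have "(\<Sum>t | q (Loop i, t) \<noteq> 0. of_int (q (Loop i, t)) * 1) = (of_int (tot (Loop i) - T i + S (i - 1)) :: real)"
      unfolding sum_Y by (simp add: tot_def)
    then have "of_int (\<Sum>t | q (Loop i, t) \<noteq> 0. q (Loop i, t)) = (0 :: real)" by (simp add: T_def)
    then show charge: "charge (l i) (\<lambda>t. q (Loop i, t))"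
      using fin supp unfolding charge_def of_int_eq_0_iff by blast
    have "(\<Sum>t | q (Loop i, t) \<noteq> 0. of_int (q (Loop i, t)) * t) = 0"
      unfolding sum_Y using jac_A[OF i] c[OF i] by (simp add: M_def)
    then show "ramp (\<lambda>t. q (Loop i, t)) (l i) = 0" using ramp_end[OF charge] by simp
  qed
  have charge_Bridge: "charge (b i) (\<lambda>t. q (Bridge i, t))" if i: "i \<in> {1..<g}" for i
  proof -
    have i': "i \<in> {1..g}" using i by auto
    have support: "t = 0 \<or> t = b i \<or> q0 (Bridge i, t) \<noteq> 0" if "q (Bridge i, t) \<noteq> 0" for t
      using that by (auto simp: q_def corr_Bridge[OF i])
    have supp_Y: "{t. q (Bridge i, t) \<noteq> 0} \<subseteq> Y"
    proof
      fix t assume "t \<in> {t. q (Bridge i, t) \<noteq> 0}"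
      then show "t \<in> Y" using support[of t] q0_mem_Y[of "Bridge i" t] mem_Y i' by blast
    qed
    have fin: "finite {t. q (Bridge i, t) \<noteq> 0}" using supp_Y fin_Y by (rule finite_subset)
    have "t \<in> {0..b i}" if "q0 (Bridge i, t) \<noteq> 0" for t
      using q0_raw[OF that] raw_Bridge by simp
    moreover have "0 \<in> {0..b i}" "b i \<in> {0..b i}" using b_nonneg[OF i] by auto
    ultimately have supp: "{t. q (Bridge i, t) \<noteq> 0} \<subseteq> {0..b i}"
      using support by blast
    have "(\<Sum>t | q (Bridge i, t) \<noteq> 0. q (Bridge i, t)) = (\<Sum>t\<in>Y. q (Bridge i, t))"
      using supp_Y fin_Y by (intro sum.mono_neutral_left) auto
    also have "\<dots> = tot (Bridge i) + T i * (\<Sum>t\<in>Y. of_bool (t = 0)) - S i * (\<Sum>t\<in>Y. of_bool (t = b i))"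
      by (simp add: q_def corr_Bridge[OF i] sum.distrib sum_subtractf tot_def flip: sum_distrib_left)
    also have "\<dots> = 0"
    proof -
      have "(\<Sum>t\<in>Y. of_bool (t = y)) = (1::int)" if "y \<in> Y" for y
        using that fin_Y by (simp add: of_bool_def)
      then show ?thesis using i' S_step[OF i'] by simp
    qed
    finally show ?thesis using fin supp by (simp add: charge_def)
  qed

  define RL where "RL i = ramp (\<lambda>t. q (Loop i, t))" for i
  define RB where "RB i = ramp (\<lambda>t. q (Bridge i, t))" for i
  \<comment> \<open>\<open>K i\<close> is the value at parameter \<open>0\<close> of loop
    \<open>i\<close>, forced by continuity along the bridge from the previous loop. Index
    \<open>0\<close> is a dummy start, which merely fixes an additive constant.\<close>
  define K where "K = rec_nat (0::real) (\<lambda>i k. k + RL i (w i) + RB i (b i) - RL (Suc i) (v (Suc i)))"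
  have K_Suc: "K (Suc i) = K i + RL i (w i) + RB i (b i) - RL (Suc i) (v (Suc i))" for i
    by (simp add: K_def)
  define F where "F x = (case fst x of Loop i \<Rightarrow> K i + RL i (snd x) | Bridge i \<Rightarrow> K i + RL i (w i) + RB i (snd x))" for x
  have RL_0: "RL i 0 = 0" "RL i (l i) = 0" if "i \<in> {1..g}" for i
    using charge_Loop[OF that] ramp_Loop[OF that] unfolding RL_def charge_def by (auto intro: ramp_0)
  have RB_0: "RB i 0 = 0" if "i \<in> {1..<g}" for i
    using charge_Bridge[OF that] unfolding RB_def charge_def by (auto intro: ramp_0)
  have F_glue: "F x = F y" if "(x, y) \<in> glue G" for x y
    using that RL_0 RB_0 by (auto simp: glue_G F_def K_Suc)
  define f where "f p = F (rep p)" for p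
  have f_eq: "f (point_of G e t) = F (e, t)" if "(e, t) \<in> raw_points G" for e t
    using glue_rel_respects[OF glue_rel_rep[OF that], of "\<lambda>x y. F x = F y"] F_glue
    by (auto simp: f_def point_of_eq reflp_def symp_def transp_def)
  have seg: "\<exists>k. \<forall>t\<in>{0..len G e}. f (point_of G e t) = k + ramp (\<lambda>t. q (e, t)) t"
    "charge (len G e) (\<lambda>t. q (e, t))" "0 \<le> len G e" if "e \<in> segs G" for e
  proof -
    obtain k where "\<And>t. F (e, t) = k + ramp (\<lambda>t. q (e, t)) t"
      by (cases e) (auto simp: F_def RL_def RB_def)
    then show "\<exists>k. \<forall>t\<in>{0..len G e}. f (point_of G e t) = k + ramp (\<lambda>t. q (e, t)) t"
      using f_eq that by (auto simp: raw_points_def)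
    show "charge (len G e) (\<lambda>t. q (e, t))" "0 \<le> len G e"
      using that charge_Loop charge_Bridge l_pos b_nonneg by (auto simp: segs_G less_imp_le)
  qed
  have "rational_function G f"
    unfolding rational_function_def
  proof
    fix e assume e: "e \<in> segs G"
    then obtain k where "\<forall>t\<in>{0..len G e}. f (point_of G e t) = k + ramp (\<lambda>t. q (e, t)) t"
      using seg(1) by blast
    then show "piecewise_integer_linear (len G e) (\<lambda>t. f (point_of G e t))"
      using seg(2,3)[OF e] by (intro piecewise_integer_linear_ramp[where q = "\<lambda>t. q (e, t)"]) (auto simp: charge_def)
  qed
  moreover have "principal_divisor G f = A"
  proof -
    have "net_slope G f x = q x" if "x \<in> raw_points G" for x
    proof -
      obtain e t where x: "x = (e, t)" by (cases x)
      then have et: "e \<in> segs G" "t \<in> {0..len G e}" using that by (auto simp: raw_points_def)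
      obtain k where "\<forall>t\<in>{0..len G e}. f (point_of G e t) = k + ramp (\<lambda>t. q (e, t)) t"
        using seg(1)[OF et(1)] by blast
      then show ?thesis unfolding x using net_slope_eq_charge[OF seg(2)[OF et(1)], of f k] et(2) by simp
    qed
    then have "push (net_slope G f) = push q"
      using points_subset_raw by (auto simp: push_def fun_eq_iff intro!: sum.cong)
    then show ?thesis by (simp add: principal_divisor_eq_push push_q)
  qed
  ultimately show thesis by (rule that)
qed

lemma jac_diff: "divisor G D \<Longrightarrow> divisor G E \<Longrightarrow> jac (\<lambda>p. D p - E p) i = jac D i - jac E i"
  by (simp add: jac_def divisor_diff(2))

theorem linearly_equivalent_iff:
  assumes "divisor G D" "divisor G E"
  shows "linearly_equivalent G D E \<longleftrightarrow> deg D = deg E \<and> (\<forall>i\<in>{1..g}. [jac D i = jac E i] (rmod l i))"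
proof -
  let ?A = "\<lambda>p. D p - E p"
  have iff: "[jac D i = jac E i] (rmod l i) \<longleftrightarrow> [jac ?A i = 0] (rmod l i)" for i
    using rcong_diff_right_cancel[of "jac D i" "jac E i" "jac E i" "l i"] by (simp add: jac_diff[OF assms])
  show ?thesis
  proof
    assume "linearly_equivalent G D E"
    then obtain f where f: "rational_function G f" "?A = principal_divisor G f"
      unfolding linearly_equivalent_def by blast
    show "deg D = deg E \<and> (\<forall>i\<in>{1..g}. [jac D i = jac E i] (rmod l i))"
      using principal_divisor_invariants[OF f(1)] deg_diff[OF assms] unfolding iff f(2) by simp
  next
    assume *: "deg D = deg E \<and> (\<forall>i\<in>{1..g}. [jac D i = jac E i] (rmod l i))"
    have "deg ?A = 0" using * deg_diff[OF assms] by simp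
    then obtain f where "rational_function G f" "principal_divisor G f = ?A"
      using principal_divisor_exists[OF divisor_diff(1)[OF assms]] * unfolding iff by blast
    then show "linearly_equivalent G D E"
      unfolding linearly_equivalent_def by metis
  qed
qed

end

section \<open>Rank on a chain of loops\<close>

context chain_of_loops
begin

sublocale loop_lengths g l v w
  by unfold_locales (rule g_pos)

lemma eff_class_rcong:
  assumes "eff_class d c" "\<And>i. i \<in> {1..g} \<Longrightarrow> [c i = c' i] (rmod l i)"
  shows "eff_class d c'"
proof (rule eff_class_cong[OF _ assms(1)])
  show "same_on (eff_atoms d) c c'"
    unfolding same_on_def using assms(2) rcong_cong_left by blast
qed

text \<open>Points on the \<open>j\<close>-th bridge are counted with loop \<open>j\<close>. If
  \<open>e i = 0\<close>, all points lie strictly before loop \<open>i\<close> or strictly after the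
  \<open>i\<close>-th bridge in this count, so they retract to \<open>v i\<close> or
  \<open>w i\<close>, and the coordinate is the required constant.\<close>

lemma eff_class_effective:
  assumes E: "divisor G E" "effective E"
  shows "eff_class (deg E) (jac E)"
proof -
  define q where "q = lift E"
  define Y where "Y = snd ` {x. q x \<noteq> 0}"
  have Y: "finite Y" "snd ` {x. lift E x \<noteq> 0} \<subseteq> Y"
    using lift_support(1)[OF E(1)] by (auto simp: Y_def q_def)
  have q_nonneg: "0 \<le> q x" for x using E(2) by (simp add: q_def lift_def effective_def)
  define tot where "tot s = (\<Sum>t\<in>Y. q (s, t))" for s
  have tot_nonneg: "0 \<le> tot s" for s by (simp add: tot_def sum_nonneg q_nonneg)
  define e where "e j = nat (tot (Loop j) + tot (Bridge j))" for j
  have e: "int (e j) = tot (Loop j) + tot (Bridge j)" for j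
    using tot_nonneg by (simp add: e_def)
  have "real_of_int (deg E) = of_int (int (\<Sum>j\<in>{1..g}. e j))"
    unfolding deg_eq_weighted_sum weighted_sum_chain[OF E(1) Y] of_nat_sum e
    by (simp add: tot_def q_def)
  then have deg: "int (\<Sum>j\<in>{1..g}. e j) = deg E" by (simp only: of_int_eq_iff)
  have "jac E i = real (\<Sum>j\<in>{1..<i}. e j) * v i + (of_int (deg E) - real (\<Sum>j\<in>{1..<i}. e j)) * w i"
    if i: "i \<in> {1..g}" "e i = 0" for i
  proof -
    define h where "h j = (\<Sum>t\<in>Y. of_int (q (Loop j, t)) * omega i (Loop j, t))
      + (\<Sum>t\<in>Y. of_int (q (Bridge j, t)) * omega i (Bridge j, t))" for j
    have e_real: "real (e j) = of_int (tot (Loop j)) + of_int (tot (Bridge j))" for j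
      using e[of j] by (metis of_int_add of_int_of_nat_eq)
    have left: "h j = real (e j) * v i" if "j < i" for j
      using that by (simp add: h_def omega_def tot_def e_real sum_distrib_right distrib_right)
    have right: "h j = real (e j) * w i" if "j > i" for j
      using that by (simp add: h_def omega_def tot_def e_real sum_distrib_right distrib_right)
    have "tot (Loop i) = 0" "tot (Bridge i) = 0"
      using e[of i] i(2) tot_nonneg[of "Loop i"] tot_nonneg[of "Bridge i"] by auto
    then have "\<forall>t\<in>Y. q (Loop i, t) = 0" "\<forall>t\<in>Y. q (Bridge i, t) = 0"
      using Y(1) q_nonneg by (simp_all add: tot_def sum_nonneg_eq_0_iff)
    then have mid: "h i = 0" by (simp add: h_def)
    have split: "{1..g} = {1..<i} \<union> {i} \<union> {i<..g}" using i by auto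
    have "jac E i = (\<Sum>j\<in>{1..g}. h j)"
      unfolding jac_def weighted_sum_chain[OF E(1) Y] by (simp add: h_def q_def)
    also have "\<dots> = (\<Sum>j\<in>{1..<i}. h j) + h i + (\<Sum>j\<in>{i<..g}. h j)"
      unfolding split by (subst sum.union_disjoint) auto
    also have "\<dots> = (\<Sum>j\<in>{1..<i}. real (e j) * v i) + (\<Sum>j\<in>{i<..g}. real (e j) * w i)"
      using left right mid by simp
    also have "\<dots> = real (\<Sum>j\<in>{1..<i}. e j) * v i + real (\<Sum>j\<in>{i<..g}. e j) * w i"
      by (simp add: sum_distrib_right)
    also have "(\<Sum>j\<in>{1..g}. e j) = (\<Sum>j\<in>{1..<i}. e j) + e i + (\<Sum>j\<in>{i<..g}. e j)"
      unfolding split by (subst sum.union_disjoint) auto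
    then have "real (\<Sum>j\<in>{i<..g}. e j) = of_int (deg E) - real (\<Sum>j\<in>{1..<i}. e j)"
      unfolding deg[symmetric] using i(2) by simp
    finally show ?thesis .
  qed
  then show ?thesis unfolding eff_class_def using deg by (intro exI[of _ e]) auto
qed

text \<open>On a loop with \<open>e i > 0\<close> points, all but one are put at \<open>0\<close>,
  where they do not contribute to the coordinate; the last point is then solved for.\<close>

lemma effective_divisor_exists:
  assumes "eff_class d c"
  obtains E where "divisor G E" "effective E" "deg E = d"
    "\<forall>i\<in>{1..g}. [jac E i = c i] (rmod l i)"
proof -
  obtain e :: "nat \<Rightarrow> nat" where e: "int (\<Sum>i\<in>{1..g}. e i) = d"
    "\<And>i. i \<in> {1..g} \<Longrightarrow> e i = 0 \<Longrightarrow>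
       [c i = real (\<Sum>j\<in>{1..<i}. e j) * v i + (of_int d - real (\<Sum>j\<in>{1..<i}. e j)) * w i] (rmod l i)"
    using assms unfolding eff_class_def by blast
  \<comment> \<open>\<open>R i\<close> is the contribution of the other loops, hence independent of
    the positions chosen on them; this makes the equations for the \<open>y i\<close>
    decouple.\<close>
  define R where "R i = real (\<Sum>j\<in>{1..<i}. e j) * v i + (of_int d - real (\<Sum>j\<in>{1..<i}. e j) - real (e i)) * w i" for i
  define y where "y i = (c i - R i) rmod l i" for i
  have y: "y i \<in> {0..l i}" "[y i = c i - R i] (rmod l i)" if "i \<in> {1..g}" for i
    using rmod_nonneg[of "l i"] rmod_le[of "l i"] l_pos[OF that] by (auto simp: y_def)
  define q :: "chain_segment \<times> real \<Rightarrow> int" where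
    "q x = (case fst x of
        Loop i \<Rightarrow> if i \<in> {1..g} \<and> 0 < e i then (int (e i) - 1) * of_bool (snd x = 0) + of_bool (snd x = y i) else 0
      | Bridge i \<Rightarrow> 0)" for x
  define Y where "Y = insert 0 (y ` {1..g})"
  have q_nonneg: "0 \<le> q x" for x by (auto simp: q_def split: chain_segment.split)
  have q_cases: "\<exists>i\<in>{1..g}. fst x = Loop i \<and> (snd x = 0 \<or> snd x = y i)" if "q x \<noteq> 0" for x
    using that by (cases "fst x") (auto simp: q_def of_bool_def split: if_splits)
  have supp: "{x. q x \<noteq> 0} \<subseteq> Loop ` {1..g} \<times> Y"
    unfolding Y_def mem_Times_iff subset_iff mem_Collect_eq using q_cases by fastforce
  have fin_Y: "finite Y" by (simp add: Y_def)
  have fin: "finite {x. q x \<noteq> 0}" by (rule finite_subset[OF supp]) (simp add: fin_Y)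
  have raw: "{x. q x \<noteq> 0} \<subseteq> raw_points G"
  proof
    fix x assume "x \<in> {x. q x \<noteq> 0}"
    then obtain i where i: "fst x = Loop i" "i \<in> {1..g}" "snd x = 0 \<or> snd x = y i"
      using q_cases by blast
    then have "(Loop i, snd x) \<in> raw_points G"
      using y(1)[OF i(2)] l_pos[OF i(2)] by (auto simp: raw_Loop)
    then show "x \<in> raw_points G" using i(1) by (metis prod.collapse)
  qed
  have sub_Y: "snd ` {x. q x \<noteq> 0} \<subseteq> Y" using supp by auto
  have q_Loop: "(\<Sum>t\<in>Y. of_int (q (Loop j, t)) * h t) = (if 0 < e j then (real (e j) - 1) * h 0 + h (y j) else 0)"
    if "j \<in> {1..g}" for j and h :: "real \<Rightarrow> real"
  proof (cases "0 < e j")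
    case True
    have delta: "(\<Sum>t\<in>Y. (if t = u then k * h t else 0)) = k * h u" if "u \<in> Y" for u k
      using that fin_Y by simp
    have "(\<Sum>t\<in>Y. of_int (q (Loop j, t)) * h t)
      = (\<Sum>t\<in>Y. (if t = 0 then (real (e j) - 1) * h t else 0) + (if t = y j then 1 * h t else 0))"
      using True that by (intro sum.cong) (auto simp: q_def algebra_simps)
    also have "\<dots> = (real (e j) - 1) * h 0 + 1 * h (y j)"
      unfolding sum.distrib using that by (intro arg_cong2[of _ _ _ _ "(+)"] delta) (auto simp: Y_def)
    finally show ?thesis using True by simp
  qed (simp add: q_def)
  have q_Bridge: "(\<Sum>t\<in>Y. of_int (q (Bridge j, t)) * h t) = (0::real)" for j h
    by (simp add: q_def)
  have "real_of_int (deg (push q)) = (\<Sum>x | q x \<noteq> 0. of_int (q x) * 1)"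
    unfolding deg_eq_weighted_sum by (rule weighted_sum_push[OF fin raw])
  also have "\<dots> = (\<Sum>j\<in>{1..g}. real (e j))"
    unfolding sum_chain[OF fin raw fin_Y sub_Y] q_Bridge by (intro sum.cong refl, subst q_Loop) auto
  also have "\<dots> = of_int d" using e(1) by (metis of_int_of_nat_eq of_nat_sum)
  finally have deg: "deg (push q) = d" by simp
  have jac: "[jac (push q) i = c i] (rmod l i)" if i: "i \<in> {1..g}" for i
  proof -
    define h where "h j = (\<Sum>t\<in>Y. of_int (q (Loop j, t)) * omega i (Loop j, t))
      + (\<Sum>t\<in>Y. of_int (q (Bridge j, t)) * omega i (Bridge j, t))" for j
    have h: "h j = (if 0 < e j then (real (e j) - 1) * omega i (Loop j, 0) + omega i (Loop j, y j) else 0)"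
      if "j \<in> {1..g}" for j
      unfolding h_def q_Bridge using q_Loop[OF that, of "\<lambda>t. omega i (Loop j, t)"] by simp
    have left: "h j = real (e j) * v i" if "j \<in> {1..<i}" for j
      using that i h[of j] by (auto simp: omega_def algebra_simps)
    have right: "h j = real (e j) * w i" if "j \<in> {i<..g}" for j
      using that i h[of j] by (auto simp: omega_def algebra_simps)
    have split: "{1..g} = {1..<i} \<union> {i} \<union> {i<..g}" using i by auto
    have "(\<Sum>j\<in>{1..g}. h j) = (\<Sum>j\<in>{1..<i}. h j) + h i + (\<Sum>j\<in>{i<..g}. h j)"
      unfolding split by (subst sum.union_disjoint) auto
    also have "\<dots> = real (\<Sum>j\<in>{1..<i}. e j) * v i + h i + real (\<Sum>j\<in>{i<..g}. e j) * w i"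
      using left right by (simp add: sum_distrib_right)
    also have "(\<Sum>j\<in>{1..g}. e j) = (\<Sum>j\<in>{1..<i}. e j) + e i + (\<Sum>j\<in>{i<..g}. e j)"
      unfolding split by (subst sum.union_disjoint) auto
    then have "real (\<Sum>j\<in>{i<..g}. e j) = of_int d - real (\<Sum>j\<in>{1..<i}. e j) - real (e i)"
      unfolding e(1)[symmetric] by simp
    finally have sum_h: "(\<Sum>j\<in>{1..g}. h j) = R i + h i" by (simp add: R_def)
    have "[jac (push q) i = (\<Sum>x | q x \<noteq> 0. of_int (q x) * omega i x)] (rmod l i)"
      unfolding jac_def weighted_sum_push[OF fin raw]
      using raw by (intro rcong_sum rcong_of_int_mult omega_rep) auto
    also have "(\<Sum>x | q x \<noteq> 0. of_int (q x) * omega i x) = R i + h i"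
      using sum_h unfolding sum_chain[OF fin raw fin_Y sub_Y] h_def .
    also have "[R i + h i = c i] (rmod l i)"
    proof (cases "e i = 0")
      case True
      then show ?thesis using rcong_sym[OF e(2)[OF i True]] h[OF i] by (simp add: R_def)
    next
      case False
      then have "h i = y i" using h[OF i] by (simp add: omega_def)
      moreover have "[R i + y i = R i + (c i - R i)] (rmod l i)"
        unfolding rcong_add_left_cancel by (rule y(2)[OF i])
      ultimately show ?thesis by simp
    qed
    finally show ?thesis .
  qed
  have "divisor G (push q)"
    unfolding divisor_def using finite_push[OF fin] by (auto simp: push_def split: if_splits)
  moreover have "effective (push q)"
    using q_nonneg by (auto simp: effective_def push_def intro!: sum_nonneg)
  ultimately show thesis using deg jac by (intro that) auto
qed

lemma linear_system_nonempty_iff: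
  assumes "divisor G D"
  shows "linear_system G D \<noteq> {} \<longleftrightarrow> eff_class (deg D) (jac D)"
proof
  assume "linear_system G D \<noteq> {}"
  then obtain E where E: "divisor G E" "effective E" "linearly_equivalent G D E"
    unfolding linear_system_def by blast
  then have "deg D = deg E" "\<forall>i\<in>{1..g}. [jac E i = jac D i] (rmod l i)"
    using linearly_equivalent_iff[OF assms E(1)] rcong_sym by blast+
  then show "eff_class (deg D) (jac D)"
    using eff_class_rcong[OF eff_class_effective[OF E(1,2)]] by simp
next
  assume "eff_class (deg D) (jac D)"
  then obtain E where E: "divisor G E" "effective E" "deg E = deg D"
    "\<forall>i\<in>{1..g}. [jac E i = jac D i] (rmod l i)"
    by (rule effective_divisor_exists)
  then have "linearly_equivalent G D E"
    using linearly_equivalent_iff[OF assms E(1)] rcong_sym by simp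
  then show "linear_system G D \<noteq> {}" using E(1,2) unfolding linear_system_def by blast
qed

text \<open>Effective divisors of degree \<open>r\<close> realise exactly the effective classes of
  that degree, up to congruence of coordinates, so both maxima are taken over the same set of
  \<open>r\<close>.\<close>

theorem divisor_rank_eq_class_rank:
  assumes "divisor G D"
  shows "divisor_rank G D = class_rank (deg D) (jac D)"
proof -
  have iff: "linear_system G (\<lambda>p. D p - E p) \<noteq> {} \<longleftrightarrow> eff_class (deg D - deg E) (\<lambda>i. jac D i - jac E i)"
    if "divisor G E" for E
  proof -
    have "jac (\<lambda>p. D p - E p) = (\<lambda>i. jac D i - jac E i)"
      using jac_diff[OF assms that] by (rule ext)
    then show ?thesis
      using linear_system_nonempty_iff[OF divisor_diff(1)[OF assms that]] deg_diff[OF assms that] by simp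
  qed
  have "(\<forall>E. divisor G E \<and> effective E \<and> deg E = int r \<longrightarrow> linear_system G (\<lambda>p. D p - E p) \<noteq> {})
      \<longleftrightarrow> class_rank_ge (deg D) (jac D) r" for r
  proof
    assume *: "\<forall>E. divisor G E \<and> effective E \<and> deg E = int r \<longrightarrow> linear_system G (\<lambda>p. D p - E p) \<noteq> {}"
    show "class_rank_ge (deg D) (jac D) r"
      unfolding class_rank_ge_def
    proof (intro allI impI)
      fix c assume "eff_class (int r) c"
      then obtain E where E: "divisor G E" "effective E" "deg E = int r"
        "\<forall>i\<in>{1..g}. [jac E i = c i] (rmod l i)"
        by (rule effective_divisor_exists)
      then have "eff_class (deg D - int r) (\<lambda>i. jac D i - jac E i)"
        using * iff[OF E(1)] by simp
      then show "eff_class (deg D - int r) (\<lambda>i. jac D i - c i)"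
        by (rule eff_class_rcong) (simp add: E(4))
    qed
  next
    assume ge: "class_rank_ge (deg D) (jac D) r"
    show "\<forall>E. divisor G E \<and> effective E \<and> deg E = int r \<longrightarrow> linear_system G (\<lambda>p. D p - E p) \<noteq> {}"
    proof (intro allI impI, elim conjE)
      fix E assume E: "divisor G E" "effective E" "deg E = int r"
      then have "eff_class (int r) (jac E)" using eff_class_effective[OF E(1,2)] by simp
      then show "linear_system G (\<lambda>p. D p - E p) \<noteq> {}"
        unfolding iff[OF E(1)] E(3) using ge by (simp add: class_rank_ge_def)
    qed
  qed
  then show ?thesis
    by (simp add: divisor_rank_def class_rank_def flip: linear_system_nonempty_iff[OF assms])
qed

end

section \<open>Rationality of the Poincare series\<close>

lemma (in chain_of_loops) rational_gf_rank:
  assumes D: "\<And>i. i < k \<Longrightarrow> divisor G (D i)"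
  shows "rational_gf k (on_vars {..<k}
    (\<lambda>n. divisor_rank G (\<lambda>p. \<Sum>i<k. int (Poly_Mapping.lookup n i) * D i p) + 1))"
proof -
  let ?N = "\<lambda>n :: expo. \<lambda>p. \<Sum>i<k. int (Poly_Mapping.lookup n i) * D i p"
  define \<delta> where "\<delta> i = deg (D i)" for i
  define J where "J n i = (\<Sum>j<k. real (Poly_Mapping.lookup n j) * jac (D j) i)" for n :: expo and i
  have N: "divisor G (?N n)" "weighted_sum \<omega> (?N n) = (\<Sum>j<k. real (Poly_Mapping.lookup n j) * weighted_sum \<omega> (D j))" for n \<omega>
    using divisor_sum(1)[of "{..<k}" D "\<lambda>i. int (Poly_Mapping.lookup n i)"]
      divisor_sum(2)[of "{..<k}" D \<omega> "\<lambda>i. int (Poly_Mapping.lookup n i)"] D by simp_all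
  have "of_int (deg (?N n)) = (of_int (lin_form k \<delta> n) :: real)" for n
    unfolding deg_eq_weighted_sum N(2) by (simp add: lin_form_def \<delta>_def deg_eq_weighted_sum)
  then have deg_N: "deg (?N n) = lin_form k \<delta> n" for n by (simp only: of_int_eq_iff)
  have jac_N: "jac (?N n) = J n" for n
    unfolding jac_def N(2) J_def by (simp add: jac_def fun_eq_iff)
  define F where "F n = class_rank (lin_form k \<delta> n) (J n) + 1" for n
  have F: "divisor_rank G (?N n) + 1 = F n" for n
    by (simp add: divisor_rank_eq_class_rank[OF N(1)] deg_N jac_N F_def)

  define H where "H n = F n - max 0 (lin_form k \<delta> n + (1 - int g))" for n
  \<comment> \<open>The degrees in which the rank is not given by the degree alone.\<close>
  define I where "I = {0..2 * int g - 2}"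
  \<comment> \<open>The constants in \<open>rank_atoms d\<close> vary with \<open>d\<close>; the
    degree conditions single out \<open>d\<close>, so that the comparisons for the right degree can
    be used.\<close>
  define \<S> where "\<S> = (\<lambda>d. {n. lin_form k \<delta> n = d}) ` I
    \<union> (\<Union>i\<in>{1..g}. \<Union>d\<in>I. (\<lambda>a. {n. [J n i = a] (rmod l i)}) ` rank_atoms d i)"
  have J_add: "J (n + m) i = J n i + J m i" for n m i
    by (simp add: J_def lookup_add distrib_right sum.distrib)
  have affine_deg: "affine_set {n. lin_form k \<delta> n = d}" for d
    unfolding affine_set_def
  proof (intro ballI allI impI)
    fix x y z w assume *: "x \<in> {n. lin_form k \<delta> n = d}" "y \<in> {n. lin_form k \<delta> n = d}" "z \<in> {n. lin_form k \<delta> n = d}" "x + y = z + w"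
    have "lin_form k \<delta> x + lin_form k \<delta> y = lin_form k \<delta> z + lin_form k \<delta> w"
      using arg_cong[OF *(4), of "lin_form k \<delta>"] by (simp only: lin_form_add)
    then show "w \<in> {n. lin_form k \<delta> n = d}" using *(1-3) by simp
  qed
  have affine_J: "affine_set {n. [J n i = a] (rmod l i)}" for i a
    unfolding affine_set_def
  proof (intro ballI allI impI)
    fix x y z w assume *: "x \<in> {n. [J n i = a] (rmod l i)}" "y \<in> {n. [J n i = a] (rmod l i)}" "z \<in> {n. [J n i = a] (rmod l i)}" "x + y = z + w"
    have "J w i = J x i + J y i - J z i"
      using arg_cong[OF *(4), of "\<lambda>n. J n i"] by (simp add: J_add)
    moreover have "[J x i + J y i - J z i = a + a - a] (rmod l i)"
      using *(1-3) by (intro rcong_diff rcong_add) auto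
    ultimately show "w \<in> {n. [J n i = a] (rmod l i)}" by simp
  qed
  have "finite \<S>" by (simp add: \<S>_def I_def finite_rank_atoms)
  moreover have "affine_set S" if "S \<in> \<S>" for S
    using that by (auto simp: \<S>_def intro: affine_deg affine_J)
  moreover have "determined_by \<S> H"
    unfolding determined_by_def
  proof (intro allI impI)
    fix n n' assume same: "\<forall>S\<in>\<S>. n \<in> S \<longleftrightarrow> n' \<in> S"
    have deg_iff: "lin_form k \<delta> n = d \<longleftrightarrow> lin_form k \<delta> n' = d" if "d \<in> I" for d
    proof -
      have "{n. lin_form k \<delta> n = d} \<in> \<S>" using that by (simp add: \<S>_def)
      from bspec[OF same this] show ?thesis by simp
    qed
    \<comment> \<open>In negative degree both terms of \<open>H\<close> are zero, as
      \<open>g \<ge> 1\<close>. From degree \<open>2 g - 1\<close> on the affine form is positive,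
      and both terms equal it.\<close>
    have outside: "H m = 0" if "lin_form k \<delta> m \<notin> I" for m
    proof (cases "lin_form k \<delta> m < 0")
      case True
      then show ?thesis using g_pos by (simp add: H_def F_def class_rank_neg)
    next
      case False
      then have "2 * int g - 1 \<le> lin_form k \<delta> m" using that by (auto simp: I_def)
      then show ?thesis using g_pos by (simp add: H_def F_def class_rank_large)
    qed
    show "H n = H n'"
    proof (cases "lin_form k \<delta> n \<in> I")
      case True
      then have eq: "lin_form k \<delta> n' = lin_form k \<delta> n" using deg_iff[OF True] by simp
      have "same_on (rank_atoms (lin_form k \<delta> n)) (J n) (J n')"
        unfolding same_on_def
      proof (intro ballI)
        fix i a assume ia: "i \<in> {1..g}" "a \<in> rank_atoms (lin_form k \<delta> n) i"
        have "{n. [J n i = a] (rmod l i)} \<in> \<S>"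
          unfolding \<S>_def by (rule UnI2, rule UN_I[OF ia(1)], rule UN_I[OF True], rule imageI[OF ia(2)])
        from bspec[OF same this] show "[J n i = a] (rmod l i) \<longleftrightarrow> [J n' i = a] (rmod l i)" by simp
      qed
      then have "class_rank (lin_form k \<delta> n) (J n) = class_rank (lin_form k \<delta> n) (J n')"
        by (rule class_rank_cong)
      then show ?thesis unfolding H_def F_def eq by (simp only:)
    next
      case False
      then have "lin_form k \<delta> n' \<notin> I" using deg_iff[of "lin_form k \<delta> n'"] by auto
      then show ?thesis using False outside by simp
    qed
  qed
  ultimately have "rational_gf k (\<lambda>n. on_vars {..<k} (indicator UNIV) n * H n)"
    by (intro rational_gf_determined_by) auto
  moreover have "rational_gf k (on_vars {..<k} (\<lambda>n. max 0 (lin_form k \<delta> n + (1 - int g))))"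
    by (rule rational_gf_max_lin_form) auto
  ultimately have "rational_gf k (\<lambda>n. on_vars {..<k} (indicator UNIV) n * H n
      + on_vars {..<k} (\<lambda>n. max 0 (lin_form k \<delta> n + (1 - int g))) n)"
    by (rule rational_gf_add)
  moreover have "on_vars {..<k} (indicator UNIV) n * H n
      + on_vars {..<k} (\<lambda>n. max 0 (lin_form k \<delta> n + (1 - int g))) n = on_vars {..<k} F n" for n
    by (simp add: on_vars_def H_def)
  ultimately show ?thesis by (simp only: F)
qed

lemma chain_of_loops_exists:
  assumes "is_chain_of_loops g G" "1 \<le> g"
  shows "\<exists>l v w b. chain_of_loops g l v w b G"
  using assms(1) unfolding is_chain_of_loops_def
proof (elim exE conjE)
  fix l v w b :: "nat \<Rightarrow> real"
  assume *: "\<forall>i\<in>{1..g}. 0 < l i" "\<forall>i\<in>{2..g}. v i \<in> {0..<l i}" "\<forall>i\<in>{1..<g}. w i \<in> {0..<l i} \<and> 0 \<le> b i"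
    and G: "G = \<lparr> segs = Loop ` {1..g} \<union> Bridge ` {1..<g},
              len = (\<lambda>e. case e of Loop i \<Rightarrow> l i | Bridge i \<Rightarrow> b i),
              glue = {((Loop i, 0), (Loop i, l i)) | i. i \<in> {1..g}}
                   \<union> {((Loop i, w i), (Bridge i, 0)) | i. i \<in> {1..<g}}
                   \<union> {((Bridge i, b i), (Loop (Suc i), v (Suc i))) | i. i \<in> {1..<g}} \<rparr>"
  have "chain_of_loops g l v w b G"
    by (rule chain_of_loops.intro[OF assms(2) _ _ _ _ G]) (use * in blast)+
  then show ?thesis by blast
qed

theorem theorem2:
  fixes g k :: nat
    and G :: "chain_segment metric_graph"
    and D :: "nat \<Rightarrow> chain_segment point \<Rightarrow> int"
  assumes "g \<ge> 1"
    and "is_chain_of_loops g G"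
    and "\<And>i. i < k \<Longrightarrow> divisor G (D i)"
  shows "\<exists>f\<in>int_polys k. \<exists>h\<in>int_polys k. h \<noteq> 0 \<and>
           (\<forall>z :: nat \<Rightarrow> complex.
              (\<lambda>n. norm (poincare_term G k D z n)) summable_on exponents k \<longrightarrow>
                poly_at k z h * infsum (poincare_term G k D z) (exponents k) = poly_at k z f \<and>
                (poly_at k z h \<noteq> 0 \<longrightarrow>
                   infsum (poincare_term G k D z) (exponents k) = poly_at k z f / poly_at k z h))"
proof -
  obtain l v w b where "chain_of_loops g l v w b G"
    using chain_of_loops_exists[OF assms(2,1)] by blast
  then interpret chain_of_loops g l v w b G .
  define a where "a = on_vars {..<k}
    (\<lambda>n. divisor_rank G (\<lambda>p. \<Sum>i<k. int (Poly_Mapping.lookup n i) * D i p) + 1)"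
  have "rational_gf k a" unfolding a_def using assms(3) by (rule rational_gf_rank)
  moreover have "a n = 0" if "n \<notin> exponents k" for n
    using that by (simp add: a_def on_vars_def exponents_def)
  ultimately obtain f h where fh: "f \<in> int_polys k" "h \<in> int_polys k" "h \<noteq> 0"
    and eval: "\<forall>z S. ((\<lambda>n. of_int (a n) * monomial_at k z n) has_sum S) (exponents k) \<longrightarrow>
      poly_at k z h * S = poly_at k z f"
    using rational_gf_eval[of k a] by metis
  have eq: "poly_at k z h * infsum (poincare_term G k D z) (exponents k) = poly_at k z f"
    if "(\<lambda>n. norm (poincare_term G k D z n)) summable_on exponents k" for z
  proof -
    let ?P = "infsum (poincare_term G k D z) (exponents k)"
    have "(poincare_term G k D z has_sum ?P) (exponents k)"
      using abs_summable_summable[OF that] by (rule has_sum_infsum)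
    also have "?this \<longleftrightarrow> ((\<lambda>n. of_int (a n) * monomial_at k z n) has_sum ?P) (exponents k)"
      by (rule has_sum_cong) (simp add: poincare_term_def a_def on_vars_def exponents_def)
    finally show ?thesis using eval by blast
  qed
  show ?thesis
  proof (rule bexI[OF _ fh(1)], rule bexI[OF _ fh(2)], intro conjI allI impI)
    fix z assume "(\<lambda>n. norm (poincare_term G k D z n)) summable_on exponents k" "poly_at k z h \<noteq> 0"
    then show "infsum (poincare_term G k D z) (exponents k) = poly_at k z f / poly_at k z h"
      using eq[of z] by (simp add: eq_divide_eq mult.commute)
  qed (use fh(3) eq in auto)
qed

end
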